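(* Let $(X_1,X_2)$ be a centered bivariate (jointly) Gaussian real random vector with $\mathbf{E}[X_1^2]=\sigma_1^2$, $\mathbf{E}[X_2^2]=\sigma_2^2$, where $\sigma_1,\sigma_2>0$, and with correlation coefficient $\rho$ satisfying $|\rho|<1$. Then for any real numbers $\alpha_1,\alpha_2$ with either $\alpha_1,\alpha_2\in(-1,0)$ or $\alpha_1,\alpha_2\in(0,\infty)$, $$\mathbf{E}[|X_1|^{\alpha_1}|X_2|^{\alpha_2}]-\mathbf{E}[|X_1|^{\alpha_1}]\,\mathbf{E}[|X_2|^{\alpha_2}]\ \ge\ f(\sigma_1,\sigma_2,\alpha_1,\alpha_2,\rho),$$ where the function $f$, which is nonnegative, is defined as follows: (a) if $-1<\alpha_1,\alpha_2<0$, or $0<\alpha_1,\alpha_2\le 2$, or $\alpha_1,\alpha_2\ge 2$, then $$f(\sigma_1,\sigma_2,\alpha_1,\alpha_2,\rho)=\frac{2^{\frac{\alpha_1+\alpha_2}{2}}\alpha_1\alpha_2\sigma_1^{\alpha_1}\sigma_2^{\alpha_2}\rho^2}{2\pi}\,\Gamma\left(\frac{\alpha_1+1}{2}\right)\Gamma\left(\frac{\alpha_2+1}{2}\right);$$ (b) if $\alpha_1>2$ and $0<\alpha_2<2$, or $0<\alpha_1<2$ and $\alpha_2>2$, then $$f(\sigma_1,\sigma_2,\alpha_1,\alpha_2,\rho)=\frac{2^{\frac{\alpha_1+\alpha_2}{2}}\alpha_1\alpha_2\sigma_1^{\alpha_1}\sigma_2^{\alpha_2}\rho^2}{4\sqr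t{\pi}}\,\Gamma\left(\frac{\alpha_1+\alpha_2-1}{2}\right).$$
   Context: $\Gamma$ denotes the Gamma function. All Gaussian random variables are real-valued and non-degenerate, so $\sigma_1,\sigma_2>0$. The correlation coefficient is $\rho=\mathbf{E}[X_1X_2]/(\sigma_1\sigma_2)$. A condition such as "$0<\alpha_1,\alpha_2\le 2$" means that both $\alpha_1$ and $\alpha_2$ satisfy it. *)

theory Defs
  imports "HOL-Probability.Probability"
begin

text \<open>
  A pair of random variables is jointly Gaussian if its joint law is the law of an affine image
  of two independent standard normal variables. Only the law is constrained, so the underlying
  probability space need not carry two such variables, and laws concentrated on a line or a point
  are allowed.
\<close>

definition jointly_gaussian ::
    "'w measure \<Rightarrow> ('w \<Rightarrow> real) \<Rightarrow> ('w \<Rightarrow> real) \<Rightarrow> bool" where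
  "jointly_gaussian M X Y \<longleftrightarrow>
     X \<in> borel_measurable M \<and> Y \<in> borel_measurable M \<and>
     (\<exists>m n a b c d :: real.
        distr M (borel \<Otimes>\<^sub>M borel) (\<lambda>\<omega>. (X \<omega>, Y \<omega>)) =
        distr (std_normal_distribution \<Otimes>\<^sub>M std_normal_distribution) (borel \<Otimes>\<^sub>M borel)
          (\<lambda>(z, w). (m + a * z + b * w, n + c * z + d * w)))"

text \<open>
  The two formulas are only meant for exponents that are both in \<open>(-1, 0)\<close> or both positive; there
  the two conditions are disjoint and exhaustive.
\<close>

definition moment_gap_bound ::
    "real \<Rightarrow> real \<Rightarrow> real \<Rightarrow> real \<Rightarrow> real \<Rightarrow> real" where
  "moment_gap_bound \<sigma>1 \<sigma>2 \<alpha>1 \<alpha>2 \<rho> =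
     (if (-1 < \<alpha>1 \<and> \<alpha>1 < 0 \<and> -1 < \<alpha>2 \<and> \<alpha>2 < 0) \<or>
         (0 < \<alpha>1 \<and> \<alpha>1 \<le> 2 \<and> 0 < \<alpha>2 \<and> \<alpha>2 \<le> 2) \<or>
         (2 \<le> \<alpha>1 \<and> 2 \<le> \<alpha>2)
      then 2 powr ((\<alpha>1 + \<alpha>2) / 2) * \<alpha>1 * \<alpha>2 * \<sigma>1 powr \<alpha>1 * \<sigma>2 powr \<alpha>2 * \<rho>\<^sup>2 / (2 * pi)
             * Gamma ((\<alpha>1 + 1) / 2) * Gamma ((\<alpha>2 + 1) / 2)
      else if (2 < \<alpha>1 \<and> 0 < \<alpha>2 \<and> \<alpha>2 < 2) \<or> (0 < \<alpha>1 \<and> \<alpha>1 < 2 \<and> 2 < \<alpha>2)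
      then 2 powr ((\<alpha>1 + \<alpha>2) / 2) * \<alpha>1 * \<alpha>2 * \<sigma>1 powr \<alpha>1 * \<sigma>2 powr \<alpha>2 * \<rho>\<^sup>2 / (4 * sqrt pi)
             * Gamma ((\<alpha>1 + \<alpha>2 - 1) / 2)
      else undefined)"

end

theory Submission
  imports Defs "HOL-Real_Asymp.Real_Asymp"
begin

text \<open>
  Expanding the mixed term \<open>exp(2 r x y)\<close> of the Gaussian density in powers of \<open>x y\<close>, where odd powers
  integrate to \<open>0\<close>, and integrating termwise gives, with \<open>a = (\<alpha>1 + 1) / 2\<close>, \<open>b = (\<alpha>2 + 1) / 2\<close> and
  Gauss's hypergeometric function \<open>F\<close>,
  \<open>E[|X1|\<^bsup>\<alpha>1\<^esup> |X2|\<^bsup>\<alpha>2\<^esup>] = E[|X1|\<^bsup>\<alpha>1\<^esup>] E[|X2|\<^bsup>\<alpha>2\<^esup>] G(\<rho>\<^sup>2)\<close>, where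
  \<open>G(x) = (1 - x)\<^bsup>a + b - 1/2\<^esup> F(a, b; 1/2; x)\<close>. Moreover \<open>G(0) = 1\<close> and \<open>G' = (\<alpha>1 \<alpha>2 / 2) H\<close> with
  \<open>H(x) = (1 - x)\<^bsup>a + b - 3/2\<^esup> F(a, b; 3/2; x)\<close>. The derivative of \<open>H\<close> has the sign of
  \<open>(2 - \<alpha>1) (2 - \<alpha>2)\<close>. If this is nonnegative, then \<open>H \<ge> H(0) = 1\<close>; otherwise \<open>H\<close> is bounded below by its
  limit at \<open>1\<close>, which Gauss's summation formula expresses by Gamma values.
\<close>

subsection \<open>The hypergeometric function on the unit interval\<close>

definition hypergeometric_coeff :: "real \<Rightarrow> real \<Rightarrow> real \<Rightarrow> nat \<Rightarrow> real" where
  "hypergeometric_coeff a b c n = pochhammer a n * pochhammer b n / (pochhammer c n * fact n)"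

definition hypergeometric :: "real \<Rightarrow> real \<Rightarrow> real \<Rightarrow> real \<Rightarrow> real" where
  "hypergeometric a b c x = (\<Sum>n. hypergeometric_coeff a b c n * x ^ n)"

lemma hypergeometric_commute: "hypergeometric a b c x = hypergeometric b a c x"
  by (simp add: hypergeometric_def hypergeometric_coeff_def mult.commute)

lemma hypergeometric_coeff_pos: "a > 0 \<Longrightarrow> b > 0 \<Longrightarrow> c > 0 \<Longrightarrow> hypergeometric_coeff a b c n > 0"
  by (simp add: hypergeometric_coeff_def pochhammer_pos)

lemma hypergeometric_coeff_Suc:
  assumes "c > 0"
  shows "real (Suc n) * hypergeometric_coeff a b c (Suc n)
    = (a + n) * (b + n) / (c + n) * hypergeometric_coeff a b c n"
  using assms unfolding hypergeometric_coeff_def pochhammer_Suc fact_Suc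
  by (simp add: divide_simps del: of_nat_Suc)

text \<open>Both \<open>c * pochhammer (c + 1) n\<close> and \<open>(c + n) * pochhammer c n\<close>
  equal \<open>pochhammer c (Suc n)\<close>. This lets the derivative formula be checked on
  coefficients with the single parameter \<open>c\<close>.\<close>

lemma hypergeometric_coeff_Suc_lower:
  assumes "c > 0"
  shows "c * hypergeometric_coeff a b c n = (c + n) * hypergeometric_coeff a b (c + 1) n"
proof -
  have "c * pochhammer (c + 1) n = (c + n) * pochhammer c n"
    using pochhammer_rec[of c n] pochhammer_rec'[of c n] by simp
  moreover have "pochhammer (c + 1) n > 0" "pochhammer c n > 0"
    using assms by (simp_all add: pochhammer_pos)
  ultimately show ?thesis
    using assms unfolding hypergeometric_coeff_def by (simp add: divide_simps mult_ac)
qed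

text \<open>Ratio test: the quotient of consecutive coefficients is a rational function of
  \<open>n\<close> with limit 1, so the radius of convergence is 1.\<close>

lemma summable_hypergeometric_coeff:
  assumes "a > 0" "b > 0" "c > 0" and x: "\<bar>x\<bar> < 1"
  shows "summable (\<lambda>n. hypergeometric_coeff a b c n * x ^ n)"
proof -
  have "norm (hypergeometric_coeff a b c n) / norm (hypergeometric_coeff a b c (Suc n))
      = (c + n) * (1 + n) / ((a + n) * (b + n))" for n
  proof -
    have "0 < c + n" "0 < a + n" "0 < b + n" using assms by linarith+
    moreover have "(1 + n) * hypergeometric_coeff a b c (Suc n) * (c + n)
        = (a + n) * (b + n) * hypergeometric_coeff a b c n"
      using hypergeometric_coeff_Suc[OF assms(3), of n a b] \<open>0 < c + n\<close> by simp
    ultimately show ?thesis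
      using hypergeometric_coeff_pos[OF assms(1-3), of n] hypergeometric_coeff_pos[OF assms(1-3), of "Suc n"]
      by (simp add: frac_eq_eq mult_ac)
  qed
  moreover have "(\<lambda>n. (c + real n) * (1 + real n) / ((a + real n) * (b + real n))) \<longlonglongrightarrow> 1"
    by real_asymp
  ultimately have "conv_radius (hypergeometric_coeff a b c) = 1"
    using conv_radius_ratio_limit_nonzero[of 1 1 "hypergeometric_coeff a b c"] by (simp add: one_ereal_def)
  then show ?thesis using x by (intro summable_in_conv_radius) simp
qed

text \<open>
  By Euler's transformation \<open>(1 - x)\<^bsup>a + b - c\<^esup> F(a, b; c; x) = F(c - a, c - b; c; x)\<close>, this is the rule
  \<open>F(a, b; c; x)' = a b / c F(a + 1, b + 1; c + 1; x)\<close> in transformed form, so that the sign of the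
  derivative can be read off the factor in front.
\<close>

lemma has_derivative_powr_mult_hypergeometric:
  assumes pos: "a > 0" "b > 0" "c > 0" and x: "\<bar>x\<bar> < 1"
  shows "((\<lambda>x. (1 - x) powr (a + b - c) * hypergeometric a b c x) has_real_derivative
    (c - a) * (c - b) / c * ((1 - x) powr (a + b - (c + 1)) * hypergeometric a b (c + 1) x)) (at x)"
proof -
  let ?k = "hypergeometric_coeff a b c" and ?s = "a + b - c"
  \<comment> \<open>Termwise differentiation at \<open>x\<close> needs convergence at some point of
    strictly larger modulus.\<close>
  obtain r where r: "\<bar>x\<bar> < r" "r < 1" using dense[OF x] by auto
  have sr: "summable (\<lambda>n. ?k n * r ^ n)" using pos r by (intro summable_hypergeometric_coeff) auto
  define D where "D = (\<Sum>n. diffs ?k n * x ^ n)"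
  have der: "(hypergeometric a b c has_real_derivative D) (at x)"
    using termdiffs_strong[OF sr, of x] r unfolding hypergeometric_def[abs_def] D_def by simp
  have sd: "summable (\<lambda>n. diffs ?k n * x ^ n)"
    by (rule termdiff_converges[of x 1])
      (use x summable_hypergeometric_coeff[OF pos] in auto)
  then have sumsD: "(\<lambda>n. diffs ?k n * x ^ n) sums D" unfolding D_def by (rule summable_sums)
  have sumsxD: "(\<lambda>n. n * ?k n * x ^ n) sums (x * D)"
  proof -
    \<comment> \<open>The truncated exponent \<open>n - Suc 0\<close> does no harm at
      \<open>n = 0\<close>, where the factor \<open>n\<close> vanishes.\<close>
    have eq: "x * (n * ?k n * x ^ (n - Suc 0)) = n * ?k n * x ^ n" for n
      by (cases n) auto
    show ?thesis
      using sums_mult[OF diffs_equiv[OF sd], of x] unfolding eq D_def .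
  qed
  have sumsF: "(\<lambda>n. ?s * (?k n * x ^ n)) sums (?s * hypergeometric a b c x)"
    unfolding hypergeometric_def by (intro sums_mult summable_sums summable_hypergeometric_coeff pos x)
  have sumsG: "(\<lambda>n. (c - a) * (c - b) / c * (hypergeometric_coeff a b (c + 1) n * x ^ n)) sums
      ((c - a) * (c - b) / c * hypergeometric a b (c + 1) x)"
    unfolding hypergeometric_def using pos x by (intro sums_mult summable_sums summable_hypergeometric_coeff) auto
  \<comment> \<open>After multiplication by \<open>c + n\<close> this rests on \<open>(a + n) * (b +
    n) - (n + a + b - c) * (c + n) = (c - a) * (c - b)\<close>, which is free of \<open>n\<close>.
    Hence \<open>(1 - x) F' - (a + b - c) F\<close> is a multiple of the series with
    \<open>c + 1\<close>.\<close>
  have coeff: "diffs ?k n * x ^ n - n * ?k n * x ^ n - ?s * (?k n * x ^ n)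
      = (c - a) * (c - b) / c * (hypergeometric_coeff a b (c + 1) n * x ^ n)" for n
  proof -
    have cn: "c + n \<noteq> 0" using pos(3) by linarith
    have *: "diffs ?k n = (a + n) * (b + n) / (c + n) * ?k n"
      using hypergeometric_coeff_Suc[OF pos(3), of n a b] by (simp add: diffs_def)
    have **: "hypergeometric_coeff a b (c + 1) n = c * ?k n / (c + n)"
      using hypergeometric_coeff_Suc_lower[OF pos(3), of a b n] cn by (simp add: divide_simps mult_ac)
    show ?thesis
      unfolding * ** using cn pos(3) by (simp add: divide_simps) (simp add: algebra_simps)
  qed
  have "D - x * D - ?s * hypergeometric a b c x = (c - a) * (c - b) / c * hypergeometric a b (c + 1) x"
    using sums_unique2[OF sums_diff[OF sums_diff[OF sumsD sumsxD] sumsF, unfolded coeff] sumsG] .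
  then have key: "(1 - x) * D = ?s * hypergeometric a b c x + (c - a) * (c - b) / c * hypergeometric a b (c + 1) x"
    by (simp add: algebra_simps)
  have "((\<lambda>x. (1 - x) powr ?s * hypergeometric a b c x) has_real_derivative
      (- ?s * (1 - x) powr (?s - 1)) * hypergeometric a b c x + D * (1 - x) powr ?s) (at x)"
    using x by (auto intro!: derivative_eq_intros der simp: algebra_simps)
  moreover have *: "(1 - x) powr ?s = (1 - x) powr (?s - 1) * (1 - x)"
    using x by (simp add: powr_diff)
  \<comment> \<open>Taking out one power less of \<open>1 - x\<close> leaves exactly the combination
    that \<open>key\<close> evaluates.\<close>
  have "(- ?s * (1 - x) powr (?s - 1)) * hypergeometric a b c x + D * (1 - x) powr ?s
     = (1 - x) powr (?s - 1) * ((1 - x) * D - ?s * hypergeometric a b c x)"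
    unfolding * by (simp add: algebra_simps)
  then have "(- ?s * (1 - x) powr (?s - 1)) * hypergeometric a b c x + D * (1 - x) powr ?s
     = (c - a) * (c - b) / c * ((1 - x) powr (a + b - (c + 1)) * hypergeometric a b (c + 1) x)"
    unfolding key by (simp add: algebra_simps)
  ultimately show ?thesis by simp
qed

section \<open>Lower bounds and a special value on [0, 1)\<close>

lemma hypergeometric_0 [simp]: "hypergeometric a b c 0 = 1"
  using powser_zero[of "hypergeometric_coeff a b c"] by (simp add: hypergeometric_def hypergeometric_coeff_def)

lemma hypergeometric_nonneg:
  assumes "a > 0" "b > 0" "c > 0" "0 \<le> x" "x < 1"
  shows "hypergeometric a b c x \<ge> 0"
  unfolding hypergeometric_def using assms
  by (intro suminf_nonneg summable_hypergeometric_coeff) (auto intro!: mult_nonneg_nonneg hypergeometric_coeff_pos[THEN less_imp_le])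

text \<open>The derivative has the sign of \<open>(c - a) * (c - b)\<close>, because the series with
  \<open>c + 1\<close> has positive coefficients. So the function is nondecreasing on [0, 1), and it
  starts at 1.\<close>

lemma hypergeometric_transform_ge_1:
  assumes pos: "a > 0" "b > 0" "c > 0" and sgn: "(c - a) * (c - b) \<ge> 0" and x: "0 \<le> x" "x < 1"
  shows "(1 - x) powr (a + b - c) * hypergeometric a b c x \<ge> 1"
proof -
  have "(1 - 0) powr (a + b - c) * hypergeometric a b c 0 \<le> (1 - x) powr (a + b - c) * hypergeometric a b c x"
  proof (rule DERIV_nonneg_imp_nondecreasing[OF x(1)])
    fix y assume "0 \<le> y" "y \<le> x"
    then have y: "\<bar>y\<bar> < 1" "0 \<le> y" "y < 1" using x by auto
    have "0 \<le> hypergeometric a b (c + 1) y" using pos y by (intro hypergeometric_nonneg) auto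
    then have "0 \<le> (c - a) * (c - b) / c * ((1 - y) powr (a + b - (c + 1)) * hypergeometric a b (c + 1) y)"
      using sgn pos(3) by simp
    with has_derivative_powr_mult_hypergeometric[OF pos y(1)]
    show "\<exists>D. ((\<lambda>x. (1 - x) powr (a + b - c) * hypergeometric a b c x) has_real_derivative D) (at y) \<and> 0 \<le> D"
      by blast
  qed
  then show ?thesis by simp
qed

text \<open>
  The quotient of the coefficients of \<open>F(a, b; c; x)\<close> and \<open>(1 - x)\<^bsup>c - a - b\<^esup>\<close> decreases to the constant of
  Gauss's summation formula, which makes an Abelian argument at \<open>x = 1\<close> unnecessary.
\<close>

lemma hypergeometric_coeff_ge_limit:
  assumes pos: "a > 0" "b > 0" "c > 0" "a + b - c > 0" and sgn: "(c - a) * (c - b) \<le> 0"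
  shows "hypergeometric_coeff a b c n
    \<ge> Gamma c * Gamma (a + b - c) / (Gamma a * Gamma b) * (pochhammer (a + b - c) n / fact n)"
proof -
  let ?s = "a + b - c"
  define r where "r n = pochhammer a n * pochhammer b n / (pochhammer c n * pochhammer ?s n)" for n
  have pp: "pochhammer y n > 0" if "y > 0" for y :: real and n
    using that by (rule pochhammer_pos)
  have "r (Suc n) \<le> r n" for n
  proof -
    \<comment> \<open>Since \<open>c + ?s = a + b\<close>, the right side minus the left side is
      \<open>c * ?s - a * b = - ((c - a) * (c - b))\<close>.\<close>
    have "(a + n) * (b + n) \<le> (c + n) * (?s + n)"
      using sgn by (simp add: algebra_simps)
    then have "(a + n) * (b + n) / ((c + n) * (?s + n)) \<le> 1"
      using pos by (subst divide_le_eq_1_pos) auto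
    moreover have "r n \<ge> 0" unfolding r_def using pos pp[of _ n] by (simp add: less_imp_le)
    ultimately have "r n * ((a + n) * (b + n) / ((c + n) * (?s + n))) \<le> r n * 1"
      by (intro mult_left_mono)
    moreover have "r (Suc n) = r n * ((a + n) * (b + n) / ((c + n) * (?s + n)))"
      unfolding r_def pochhammer_Suc by (simp add: mult_ac)
    ultimately show ?thesis by simp
  qed
  then have "decseq r" by (rule decseq_SucI)
  moreover have "r \<longlonglongrightarrow> Gamma c * Gamma ?s / (Gamma a * Gamma b)"
  proof (rule Lim_transform_eventually)
    show "(\<lambda>n. Gamma_series' c n * Gamma_series' ?s n / (Gamma_series' a n * Gamma_series' b n))
      \<longlonglongrightarrow> Gamma c * Gamma ?s / (Gamma a * Gamma b)"
      using pos by (intro tendsto_intros Gamma_series'_LIMSEQ) (auto simp: Gamma_eq_zero_iff)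
    \<comment> \<open>The powers of \<open>n\<close> in the four Gamma approximants cancel because
      \<open>c + ?s = a + b\<close>, and so do the factorials. What remains is \<open>r n\<close>
      for every \<open>n\<close>.\<close>
    have "exp (c * t) * exp (?s * t) = exp (a * t) * exp (b * t)" for t :: real
      by (simp flip: exp_add add: algebra_simps)
    then show "\<forall>\<^sub>F n in sequentially. Gamma_series' c n * Gamma_series' ?s n /
        (Gamma_series' a n * Gamma_series' b n) = r n"
      using pp[OF pos(1)] pp[OF pos(2)] pp[OF pos(3)] pp[OF pos(4)]
      by (intro always_eventually allI)
        (simp add: Gamma_series'_def r_def divide_simps less_imp_neq[THEN not_sym])
  qed
  ultimately have "r n \<ge> Gamma c * Gamma ?s / (Gamma a * Gamma b)"
    by (rule decseq_ge)
  then have "Gamma c * Gamma ?s / (Gamma a * Gamma b) * (pochhammer ?s n / fact n)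
     \<le> r n * (pochhammer ?s n / fact n)"
    using pp[OF pos(4), of n] by (intro mult_right_mono) auto
  also have "\<dots> = hypergeometric_coeff a b c n"
    using pp[OF pos(4), of n] by (simp add: r_def hypergeometric_coeff_def divide_simps)
  finally show ?thesis .
qed

text \<open>Summing the coefficient bound gives a constant times the binomial series of
  \<open>(1 - x) powr (- (a + b - c))\<close>; the power in front of the hypergeometric function
  cancels it.\<close>

lemma hypergeometric_transform_ge_Gauss:
  assumes pos: "a > 0" "b > 0" "c > 0" "a + b - c > 0" and sgn: "(c - a) * (c - b) \<le> 0"
    and x: "0 \<le> x" "x < 1"
  shows "(1 - x) powr (a + b - c) * hypergeometric a b c x
    \<ge> Gamma c * Gamma (a + b - c) / (Gamma a * Gamma b)"
proof -
  let ?s = "a + b - c" and ?K = "Gamma c * Gamma (a + b - c) / (Gamma a * Gamma b)"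
  have "(- ?s gchoose n) * (- x) ^ n = pochhammer ?s n / fact n * x ^ n" for n
  proof -
    have "(- 1) ^ n * (- x) ^ n = x ^ n" by (simp flip: power_mult_distrib)
    then show ?thesis by (simp add: gbinomial_pochhammer mult_ac)
  qed
  then have "(\<lambda>n. pochhammer ?s n / fact n * x ^ n) sums (1 - x) powr (- ?s)"
    using gen_binomial_real[of "- x" "- ?s"] x by simp
  then have 1: "(\<lambda>n. ?K * (pochhammer ?s n / fact n * x ^ n)) sums (?K * (1 - x) powr (- ?s))"
    by (rule sums_mult)
  have 2: "(\<lambda>n. hypergeometric_coeff a b c n * x ^ n) sums hypergeometric a b c x"
    unfolding hypergeometric_def using pos x by (intro summable_sums summable_hypergeometric_coeff) auto
  have 3: "?K * (pochhammer ?s n / fact n * x ^ n) \<le> hypergeometric_coeff a b c n * x ^ n" for n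
    using mult_right_mono[OF hypergeometric_coeff_ge_limit[OF pos sgn, of n], of "x ^ n"] x
    by (simp add: mult_ac)
  have "?K * (1 - x) powr (- ?s) \<le> hypergeometric a b c x"
    by (rule sums_le[OF 3 1 2])
  then have "(1 - x) powr ?s * (?K * (1 - x) powr (- ?s)) \<le> (1 - x) powr ?s * hypergeometric a b c x"
    by (intro mult_left_mono) auto
  moreover have "(1 - x) powr ?s * (1 - x) powr (- ?s) = 1"
    using x by (simp flip: powr_add)
  ultimately show ?thesis by (simp add: mult_ac)
qed

text \<open>Integrates the derivative formula with \<open>c = 1 / 2\<close>, where its coefficient is \<open>\<alpha> * \<beta> / 2\<close>.\<close>

lemma gap_lower_bound:
  fixes \<alpha> \<beta> L :: real
  defines "a \<equiv> (\<alpha> + 1) / 2" and "b \<equiv> (\<beta> + 1) / 2"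
  assumes pos: "\<alpha> > -1" "\<beta> > -1" and sgn: "\<alpha> * \<beta> \<ge> 0" and x: "0 \<le> x" "x < 1"
    and L: "\<And>y. 0 \<le> y \<Longrightarrow> y < 1 \<Longrightarrow> (1 - y) powr (a + b - 3/2) * hypergeometric a b (3/2) y \<ge> L"
  shows "(1 - x) powr (a + b - 1/2) * hypergeometric a b (1/2) x - 1 \<ge> \<alpha> * \<beta> / 2 * L * x"
proof -
  \<comment> \<open>With the linear term subtracted the claim becomes
    \<open>?G 0 \<le> ?G x\<close>, as \<open>?G 0 = 1\<close>.\<close>
  let ?G = "\<lambda>y. (1 - y) powr (a + b - 1/2) * hypergeometric a b (1/2) y - \<alpha> * \<beta> / 2 * L * y"
  have ab: "a > 0" "b > 0" using pos by (auto simp: a_def b_def)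
  have "?G 0 \<le> ?G x"
  proof (rule DERIV_nonneg_imp_nondecreasing[OF x(1)])
    fix y assume y: "0 \<le> y" "y \<le> x"
    have e: "(1/2 - a) * (1/2 - b) / (1/2) = \<alpha> * \<beta> / 2"
      by (simp add: a_def b_def field_simps)
    have "((\<lambda>y. (1 - y) powr (a + b - 1/2) * hypergeometric a b (1/2) y) has_real_derivative
        \<alpha> * \<beta> / 2 * ((1 - y) powr (a + b - 3/2) * hypergeometric a b (3/2) y)) (at y)"
      using has_derivative_powr_mult_hypergeometric[of a b "1/2" y] ab x y unfolding e by simp
    from DERIV_diff[OF this DERIV_cmult_Id[of "\<alpha> * \<beta> / 2 * L"]]
    have "(?G has_real_derivative
        \<alpha> * \<beta> / 2 * ((1 - y) powr (a + b - 3/2) * hypergeometric a b (3/2) y) - \<alpha> * \<beta> / 2 * L) (at y)" .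
    moreover have "\<alpha> * \<beta> / 2 * L \<le> \<alpha> * \<beta> / 2 * ((1 - y) powr (a + b - 3/2) * hypergeometric a b (3/2) y)"
      using L[of y] y x sgn by (intro mult_left_mono) auto
    ultimately show "\<exists>D. (?G has_real_derivative D) (at y) \<and> 0 \<le> D"
      by (intro exI[of _ "\<alpha> * \<beta> / 2 * ((1 - y) powr (a + b - 3/2) * hypergeometric a b (3/2) y) - \<alpha> * \<beta> / 2 * L"]) auto
  qed
  then show ?thesis by simp
qed

text \<open>For \<open>b = c\<close> the factor \<open>c - b\<close> in the derivative formula
  vanishes, so the function keeps its value at 0. This evaluates the moments with one exponent equal
  to 0.\<close>

lemma hypergeometric_half_cancel:
  assumes "a > 0" "0 \<le> x" "x < 1"
  shows "(1 - x) powr a * hypergeometric a (1/2) (1/2) x = 1"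
proof -
  have "(1 - x) powr (a + 1/2 - 1/2) * hypergeometric a (1/2) (1/2) x
      = (1 - 0) powr (a + 1/2 - 1/2) * hypergeometric a (1/2) (1/2) 0"
  \<comment> \<open>The open interval (-1, 1) contains both 0 and \<open>x\<close>, so only
    two-sided derivatives occur.\<close>
  proof (rule DERIV_isconst3[of "- 1" 1 x 0])
    show "((\<lambda>x. (1 - x) powr (a + 1/2 - 1/2) * hypergeometric a (1/2) (1/2) x) has_real_derivative 0) (at y)"
      if "y \<in> {-1<..<1}" for y
      using has_derivative_powr_mult_hypergeometric[of a "1/2" "1/2" y] assms that by (simp add: abs_less_iff)
  qed (use assms in auto)
  then show ?thesis by simp
qed

subsection \<open>Absolute moments of a quadratic Gaussian weight\<close>

text \<open>The substitution \<open>t = p * x^2\<close> turns Euler's integral for Gamma into the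
  integral over the positive half-line; reflection doubles it.\<close>

lemma nn_integral_abs_powr_exp_square:
  fixes s p :: real
  assumes s: "s > -1" and p: "p > 0"
  shows "(\<integral>\<^sup>+x. ennreal (\<bar>x\<bar> powr s * exp (- p * x\<^sup>2)) \<partial>lborel)
    = ennreal (Gamma ((s + 1) / 2) * p powr (- ((s + 1) / 2)))"
proof -
  let ?z = "(s + 1) / 2"
  define f where "f t = t powr (?z - 1) / exp t" for t :: real
  define g where "g x = p * x\<^sup>2" for x :: real
  have z: "?z > 0" using s by simp
  have "(f has_integral Gamma ?z) {0..}"
    unfolding f_def[abs_def] by (rule Gamma_integral_real[OF z])
  \<comment> \<open>The point 0 is dropped so that \<open>g\<close> maps the open half-line
    bijectively onto itself.\<close>
  moreover have "negligible (sym_diff {0..} {0::real<..})"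
    by (rule negligible_subset[of "{0}"]) auto
  ultimately have I: "(f has_integral Gamma ?z) {0<..}"
    by (subst (asm) has_integral_spike_set_eq) (auto elim: negligible_subset)
  have img: "g ` {0<..} = {0<..}"
  proof (intro equalityI subsetI)
    fix y :: real assume "y \<in> {0<..}"
    then show "y \<in> g ` {0<..}"
      using p by (intro image_eqI[of _ _ "sqrt (y / p)"]) (auto simp: g_def)
  qed (use p in \<open>auto simp: g_def\<close>)
  have inj: "inj_on g {0<..}"
    using p by (auto simp: inj_on_def g_def)
  have "f absolutely_integrable_on {0<..}"
    using I by (intro nonnegative_absolutely_integrable_1) (auto simp: f_def has_integral_integrable)
  then have "f absolutely_integrable_on (g ` {0<..}) \<and> integral (g ` {0<..}) f = Gamma ?z"
    using I by (simp add: img integral_unique)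
  moreover have "(g has_field_derivative 2 * p * x) (at x within {0<..})" for x
    unfolding g_def by (auto intro!: derivative_eq_intros)
  ultimately have "(\<lambda>x. \<bar>2 * p * x\<bar> * f (g x)) absolutely_integrable_on {0<..} \<and>
      integral {0<..} (\<lambda>x. \<bar>2 * p * x\<bar> * f (g x)) = Gamma ?z"
    using has_absolute_integral_change_of_variables_1'[of "{0<..}" g "\<lambda>x. 2 * p * x" f "Gamma ?z"] inj
    by simp
  then have J: "((\<lambda>x. \<bar>2 * p * x\<bar> * f (g x)) has_integral Gamma ?z) {0<..}"
    using has_integral_integral set_lebesgue_integral_eq_integral(1) by metis
  \<comment> \<open>The powers of \<open>x\<close> add up to \<open>1 + 2 * (?z - 1) = s\<close>,
    those of \<open>p\<close> to \<open>?z\<close>.\<close>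
  have e: "\<bar>2 * p * x\<bar> * f (g x) = 2 * p powr ?z * (x powr s * exp (- p * x\<^sup>2))" if "x \<in> {0<..}" for x
  proof -
    have x: "x > 0" using that by simp
    have "2 * (?z - 1) = s - 1" by (simp add: field_simps)
    then have "(x\<^sup>2) powr (?z - 1) = x powr (s - 1)"
      using x powr_powr[of x 2 "?z - 1"] by (simp del: right_diff_distrib_numeral)
    then have "x * (x\<^sup>2) powr (?z - 1) = x powr s"
      using x by (simp add: powr_mult_base)
    moreover have "p * p powr (?z - 1) = p powr ?z"
    proof -
      have "y * y powr (e - 1) = y powr e" if "y > 0" for y e :: real
        using that by (simp add: powr_diff)
      then show ?thesis using p .
    qed
    moreover have "p * x * (p * x\<^sup>2) powr (?z - 1) = (p * p powr (?z - 1)) * (x * (x\<^sup>2) powr (?z - 1))"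
      using x p by (simp add: powr_mult)
    ultimately have "p * x * (p * x\<^sup>2) powr (?z - 1) = p powr ?z * x powr s"
      by (simp only:)
    moreover have "\<bar>2 * p * x\<bar> * f (g x)
        = 2 * (p * x * (p * x\<^sup>2) powr (?z - 1)) * exp (- p * x\<^sup>2)"
    proof -
      have "f (g x) = (p * x\<^sup>2) powr (?z - 1) * exp (- p * x\<^sup>2)"
        unfolding f_def g_def by (simp only: exp_minus divide_inverse mult_minus_left)
      moreover have "\<bar>2 * p * x\<bar> = 2 * (p * x)" using x p by simp
      ultimately show ?thesis by (simp only: mult.assoc)
    qed
    ultimately show ?thesis
      by (simp only: mult.assoc)
  qed
  have "((\<lambda>x. 2 * p powr ?z * (x powr s * exp (- p * x\<^sup>2))) has_integral Gamma ?z) {0<..}"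
    using has_integral_eq[OF e J] .
  from has_integral_mult_right[OF this, of "1 / (2 * p powr ?z)"]
  have K: "((\<lambda>x. x powr s * exp (- p * x\<^sup>2)) has_integral Gamma ?z / (2 * p powr ?z)) {0<..}"
    using p by simp
  define h where "h x = ennreal (indicator {0<..} x * (x powr s * exp (- p * x\<^sup>2)))" for x :: real
  have [measurable]: "h \<in> borel_measurable borel" unfolding h_def by measurable
  have hI: "(\<integral>\<^sup>+x. h x \<partial>lborel) = ennreal (Gamma ?z / (2 * p powr ?z))"
    unfolding h_def by (rule nn_integral_has_integral_lebesgue[OF _ K]) auto
  \<comment> \<open>The identity of the integrands holds at \<open>x = 0\<close> too: both copies of
    \<open>h\<close> vanish there, and \<open>0 powr s = 0\<close>.\<close>
  have "(\<integral>\<^sup>+x. ennreal (\<bar>x\<bar> powr s * exp (- p * x\<^sup>2)) \<partial>lborel) = (\<integral>\<^sup>+x. h x + h (0 + (-1) * x) \<partial>lborel)"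
    by (intro nn_integral_cong) (auto simp: h_def indicator_def abs_if)
  also have "\<dots> = (\<integral>\<^sup>+x. h x \<partial>lborel) + (\<integral>\<^sup>+x. h (0 + (-1) * x) \<partial>lborel)"
    by (intro nn_integral_add) auto
  also have "(\<integral>\<^sup>+x. h (0 + (-1) * x) \<partial>lborel) = (\<integral>\<^sup>+x. h x \<partial>lborel)"
    using nn_integral_real_affine[of h "-1" 0] by simp
  also have "(\<integral>\<^sup>+x. h x \<partial>lborel) + (\<integral>\<^sup>+x. h x \<partial>lborel) = ennreal (Gamma ?z * p powr (- ?z))"
  proof -
    have "Gamma ?z / (2 * p powr ?z) \<ge> 0"
      using z by (intro divide_nonneg_nonneg Gamma_real_nonneg) auto
    moreover have "Gamma ?z / (2 * p powr ?z) + Gamma ?z / (2 * p powr ?z) = Gamma ?z * p powr (- ?z)"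
      unfolding powr_minus_divide by (simp only: mult_2[symmetric]) simp
    ultimately show ?thesis
      unfolding hI by (simp only: ennreal_plus[symmetric])
  qed
  finally show ?thesis .
qed

text \<open>For \<open>a \<noteq> 0\<close> the matrix splits into two one-dimensional affine
  substitutions with Tonelli in between: first \<open>y = c / a * x + k * w\<close> for fixed
  \<open>x\<close>, then \<open>x = b * w + a * z\<close> for fixed \<open>w\<close>. The scale
  factors \<open>k = (a * d - b * c) / a\<close> and \<open>a\<close> multiply to the
  determinant.\<close>

lemma nn_integral_linear_change_of_variables:
  fixes a b c d :: real and H :: "real \<Rightarrow> real \<Rightarrow> ennreal"
  assumes H: "case_prod H \<in> borel_measurable (borel \<Otimes>\<^sub>M borel)" and D: "a * d - b * c \<noteq> 0"
  shows "(\<integral>\<^sup>+x. \<integral>\<^sup>+y. H x y \<partial>lborel \<partial>lborel)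
    = ennreal \<bar>a * d - b * c\<bar> * (\<integral>\<^sup>+z. \<integral>\<^sup>+w. H (a * z + b * w) (c * z + d * w) \<partial>lborel \<partial>lborel)"
proof -
  have *: "(\<integral>\<^sup>+x. \<integral>\<^sup>+y. H x y \<partial>lborel \<partial>lborel)
    = ennreal \<bar>a * d - b * c\<bar> * (\<integral>\<^sup>+w. \<integral>\<^sup>+z. H (a * z + b * w) (c * z + d * w) \<partial>lborel \<partial>lborel)"
    if a: "a \<noteq> 0" and D: "a * d - b * c \<noteq> 0" for a b c d
  proof -
    let ?k = "(a * d - b * c) / a"
    note [measurable] = measurable_compose[OF measurable_Pair H, simplified]
    have k: "?k \<noteq> 0" using a D by simp
    have "(\<integral>\<^sup>+x. \<integral>\<^sup>+y. H x y \<partial>lborel \<partial>lborel)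
        = (\<integral>\<^sup>+x. ennreal \<bar>?k\<bar> * (\<integral>\<^sup>+w. H x (c / a * x + ?k * w) \<partial>lborel) \<partial>lborel)"
      by (intro nn_integral_cong nn_integral_real_affine k) measurable
    also have "\<dots> = ennreal \<bar>?k\<bar> * (\<integral>\<^sup>+x. \<integral>\<^sup>+w. H x (c / a * x + ?k * w) \<partial>lborel \<partial>lborel)"
      by (intro nn_integral_cmult) measurable
    also have "(\<integral>\<^sup>+x. \<integral>\<^sup>+w. H x (c / a * x + ?k * w) \<partial>lborel \<partial>lborel)
        = (\<integral>\<^sup>+w. \<integral>\<^sup>+x. H x (c / a * x + ?k * w) \<partial>lborel \<partial>lborel)"
      by (rule lborel_pair.Fubini'[symmetric]) measurable
    also have "\<dots> = (\<integral>\<^sup>+w. ennreal \<bar>a\<bar> *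
        (\<integral>\<^sup>+z. H (b * w + a * z) (c / a * (b * w + a * z) + ?k * w) \<partial>lborel) \<partial>lborel)"
      by (intro nn_integral_cong nn_integral_real_affine a) measurable
    also have "\<dots> = ennreal \<bar>a\<bar> *
        (\<integral>\<^sup>+w. \<integral>\<^sup>+z. H (b * w + a * z) (c / a * (b * w + a * z) + ?k * w) \<partial>lborel \<partial>lborel)"
      by (intro nn_integral_cmult) measurable
    also have "(\<lambda>w z. H (b * w + a * z) (c / a * (b * w + a * z) + ?k * w))
        = (\<lambda>w z. H (a * z + b * w) (c * z + d * w))"
      using a by (intro ext arg_cong2[of _ _ _ _ H]) (simp_all add: field_simps)
    finally show ?thesis
      using a by (simp add: mult.assoc[symmetric] flip: ennreal_mult')
  qed
  show ?thesis
  proof (cases "a = 0")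
    case False
    note [measurable] = measurable_compose[OF measurable_Pair H, simplified]
    have "(\<integral>\<^sup>+w. \<integral>\<^sup>+z. H (a * z + b * w) (c * z + d * w) \<partial>lborel \<partial>lborel)
        = (\<integral>\<^sup>+z. \<integral>\<^sup>+w. H (a * z + b * w) (c * z + d * w) \<partial>lborel \<partial>lborel)"
      by (rule lborel_pair.Fubini') measurable
    with *[OF False D] show ?thesis by simp
  next
    case True
    \<comment> \<open>Here \<open>b \<noteq> 0\<close>, and the first case is applied with the
      columns swapped. This also exchanges \<open>z\<close> and \<open>w\<close>, so the order of
      integration is already the claimed one.\<close>
    with D *[of b c a d] show ?thesis by (simp add: abs_mult mult.commute add.commute)
  qed
qed

text \<open>By evenness of \<open>f\<close>, the reflection of \<open>x\<close> gives the same
  integral with \<open>exp (- (t * x))\<close>; \<open>cosh\<close> is the mean of the two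
  exponentials. Its series has only nonnegative terms, which later allows termwise
  integration.\<close>

lemma nn_integral_even_exp_eq_cosh:
  fixes f :: "real \<Rightarrow> real" and t :: real
  assumes [measurable]: "f \<in> borel_measurable borel"
    and nonneg: "\<And>x. f x \<ge> 0" and even: "\<And>x. f (- x) = f x"
  shows "(\<integral>\<^sup>+x. ennreal (f x * exp (t * x)) \<partial>lborel) = (\<integral>\<^sup>+x. ennreal (f x * cosh (t * x)) \<partial>lborel)"
proof -
  let ?J = "\<integral>\<^sup>+x. ennreal (f x * exp (t * x)) \<partial>lborel"
  have "(\<integral>\<^sup>+x. ennreal (f x * exp (- (t * x))) \<partial>lborel) = ?J"
    using nn_integral_real_affine[of "\<lambda>x. ennreal (f x * exp (t * x))" "-1" 0] by (simp add: even)
  moreover have "(\<integral>\<^sup>+x. ennreal (f x * cosh (t * x)) \<partial>lborel)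
      = (\<integral>\<^sup>+x. ennreal (1/2) * ennreal (f x * exp (t * x)) + ennreal (1/2) * ennreal (f x * exp (- (t * x))) \<partial>lborel)"
  proof (intro nn_integral_cong)
    fix x
    have "f x * cosh (t * x) = 1/2 * (f x * exp (t * x)) + 1/2 * (f x * exp (- (t * x)))"
      by (simp add: cosh_def field_simps)
    then have "ennreal (f x * cosh (t * x))
        = ennreal (1/2 * (f x * exp (t * x))) + ennreal (1/2 * (f x * exp (- (t * x))))"
      using nonneg[of x] by (simp del: ennreal_plus flip: ennreal_plus)
    also have "\<dots> = ennreal (1/2) * ennreal (f x * exp (t * x)) + ennreal (1/2) * ennreal (f x * exp (- (t * x)))"
      by (simp only: ennreal_mult' zero_le_divide_1_iff zero_le_numeral)
    finally show "ennreal (f x * cosh (t * x))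
        = ennreal (1/2) * ennreal (f x * exp (t * x)) + ennreal (1/2) * ennreal (f x * exp (- (t * x)))" .
  qed
  moreover have "\<dots> = ennreal (1/2) * ?J + ennreal (1/2) * (\<integral>\<^sup>+x. ennreal (f x * exp (- (t * x))) \<partial>lborel)"
    by (subst nn_integral_add) (auto simp: nn_integral_cmult)
  ultimately have "(\<integral>\<^sup>+x. ennreal (f x * cosh (t * x)) \<partial>lborel) = (ennreal (1/2) + ennreal (1/2)) * ?J"
    by (simp add: distrib_right)
  also have "ennreal (1/2) + ennreal (1/2) = 1"
    by (subst ennreal_plus[symmetric]) auto
  finally show ?thesis by simp
qed

lemma cosh_sums_even: "(\<lambda>n. x ^ (2 * n) / fact (2 * n)) sums cosh (x :: real)"
proof -
  have "(\<lambda>n. if even (2 * n) then x ^ (2 * n) /\<^sub>R fact (2 * n) else 0) sums cosh x"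
    by (subst sums_mono_reindex[of "\<lambda>n. 2 * n"])
      (auto simp: strict_mono_def cosh_converges elim!: evenE)
  then show ?thesis by (simp add: divide_inverse mult.commute)
qed

lemma abs_powr_mult_even_power:
  "\<bar>x\<bar> powr s * x ^ (2 * n) = \<bar>x\<bar> powr (s + 2 * real n)" for x s :: real
\<comment> \<open>At \<open>x = 0\<close> both sides are 0, whatever the exponents, because
  \<open>0 powr s = 0\<close>.\<close>
proof (cases "x = 0")
  case False
  then have "x ^ (2 * n) = \<bar>x\<bar> powr (2 * real n)"
    using powr_realpow[of "\<bar>x\<bar>" "2 * n"] by (simp add: power_even_abs)
  then show ?thesis by (simp add: powr_add)
qed simp

text \<open>For fixed \<open>x\<close> the rest of the weight is even in \<open>y\<close>, so the
  mixed exponential may be replaced by \<open>cosh\<close>. Its expansion is a series of nonnegative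
  products of a function of \<open>x\<close> and a function of \<open>y\<close>, so sum and
  integrals interchange. The value may be infinite here.\<close>

lemma nn_integral_abs_powr_exp_quadratic_form:
  fixes \<alpha> \<beta> p q r :: real
  defines "a \<equiv> (\<alpha> + 1) / 2" and "b \<equiv> (\<beta> + 1) / 2"
  assumes \<alpha>: "\<alpha> > -1" and \<beta>: "\<beta> > -1" and p: "p > 0" and q: "q > 0"
  shows "(\<integral>\<^sup>+x. \<integral>\<^sup>+y. ennreal (\<bar>x\<bar> powr \<alpha> * \<bar>y\<bar> powr \<beta> * exp (- p * x\<^sup>2 - q * y\<^sup>2 + 2 * r * x * y)) \<partial>lborel \<partial>lborel)
    = (\<Sum>n. ennreal ((2 * r) ^ (2 * n) / fact (2 * n) *
        (Gamma (a + n) * p powr (- (a + n))) * (Gamma (b + n) * q powr (- (b + n)))))"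
proof -
  \<comment> \<open>\<open>u n\<close> and \<open>v n\<close> absorb the powers
    \<open>x ^ (2 * n)\<close> and \<open>y ^ (2 * n)\<close> of the \<open>n\<close>-th term, and
    \<open>k n\<close> is its remaining constant.\<close>
  define u where "u n x = \<bar>x\<bar> powr (\<alpha> + 2 * real n) * exp (- p * x\<^sup>2)" for n and x :: real
  define v where "v n y = \<bar>y\<bar> powr (\<beta> + 2 * real n) * exp (- q * y\<^sup>2)" for n and y :: real
  define k where "k n = (2 * r) ^ (2 * n) / fact (2 * n)" for n
  have k: "k n \<ge> 0" for n by (simp add: k_def)
  have uv: "u n x \<ge> 0" "v n x \<ge> 0" for n x by (simp_all add: u_def v_def)
  have [measurable]: "u n \<in> borel_measurable borel" "v n \<in> borel_measurable borel" for n
    unfolding u_def v_def by measurable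
  have "(\<integral>\<^sup>+x. \<integral>\<^sup>+y. ennreal (\<bar>x\<bar> powr \<alpha> * \<bar>y\<bar> powr \<beta> * exp (- p * x\<^sup>2 - q * y\<^sup>2 + 2 * r * x * y)) \<partial>lborel \<partial>lborel)
    = (\<integral>\<^sup>+x. \<integral>\<^sup>+y. ennreal (u 0 x * v 0 y * exp ((2 * r * x) * y)) \<partial>lborel \<partial>lborel)"
    unfolding u_def v_def by (simp add: exp_add exp_diff exp_minus divide_inverse mult_ac)
  also have "\<dots> = (\<integral>\<^sup>+x. \<integral>\<^sup>+y. ennreal (u 0 x * v 0 y * cosh ((2 * r * x) * y)) \<partial>lborel \<partial>lborel)"
    using uv by (intro nn_integral_cong nn_integral_even_exp_eq_cosh) (auto simp: v_def)
  also have "\<dots> = (\<integral>\<^sup>+x. \<integral>\<^sup>+y. (\<Sum>n. ennreal (k n * u n x * v n y)) \<partial>lborel \<partial>lborel)"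
  proof (intro nn_integral_cong)
    fix x y
    have "(\<lambda>n. u 0 x * v 0 y * (((2 * r * x) * y) ^ (2 * n) / fact (2 * n)))
        sums (u 0 x * v 0 y * cosh ((2 * r * x) * y))"
      by (intro sums_mult cosh_sums_even)
    also have "(\<lambda>n. u 0 x * v 0 y * (((2 * r * x) * y) ^ (2 * n) / fact (2 * n)))
        = (\<lambda>n. k n * u n x * v n y)"
      by (simp add: u_def v_def k_def power_mult_distrib flip: abs_powr_mult_even_power) (simp add: mult_ac)
    finally show "ennreal (u 0 x * v 0 y * cosh ((2 * r * x) * y)) = (\<Sum>n. ennreal (k n * u n x * v n y))"
      using uv k by (intro suminf_ennreal_eq[symmetric]) auto
  qed
  also have "\<dots> = (\<Sum>n. \<integral>\<^sup>+x. \<integral>\<^sup>+y. ennreal (k n * u n x * v n y) \<partial>lborel \<partial>lborel)"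
    by (simp add: nn_integral_suminf)
  also have "\<dots> = (\<Sum>n. ennreal (k n) * (\<integral>\<^sup>+x. ennreal (u n x) \<partial>lborel) * (\<integral>\<^sup>+y. ennreal (v n y) \<partial>lborel))"
    using uv k by (simp add: ennreal_mult nn_integral_cmult nn_integral_multc)
  also have "\<dots> = (\<Sum>n. ennreal (k n * (Gamma (a + n) * p powr (- (a + n))) * (Gamma (b + n) * q powr (- (b + n)))))"
  proof (intro suminf_cong)
    fix n
    have e: "(\<alpha> + 2 * real n + 1) / 2 = a + n" "(\<beta> + 2 * real n + 1) / 2 = b + n"
      by (simp_all add: a_def b_def field_simps)
    have "(\<integral>\<^sup>+x. ennreal (u n x) \<partial>lborel) = ennreal (Gamma (a + n) * p powr (- (a + n)))"
      using nn_integral_abs_powr_exp_square[of "\<alpha> + 2 * real n" p] \<alpha> p unfolding u_def e by simp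
    moreover have "(\<integral>\<^sup>+x. ennreal (v n x) \<partial>lborel) = ennreal (Gamma (b + n) * q powr (- (b + n)))"
      using nn_integral_abs_powr_exp_square[of "\<beta> + 2 * real n" q] \<beta> q unfolding v_def e by simp
    moreover have "Gamma (a + n) \<ge> 0" "Gamma (b + n) \<ge> 0"
      using \<alpha> \<beta> by (auto intro!: Gamma_real_nonneg simp: a_def b_def add_pos_nonneg)
    ultimately show "ennreal (k n) * (\<integral>\<^sup>+x. ennreal (u n x) \<partial>lborel) * (\<integral>\<^sup>+y. ennreal (v n y) \<partial>lborel)
      = ennreal (k n * (Gamma (a + n) * p powr (- (a + n))) * (Gamma (b + n) * q powr (- (b + n))))"
      using k[of n] by (simp add: ennreal_mult)
  qed
  finally show ?thesis unfolding k_def .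
qed

text \<open>The identity \<open>(2n)! = 4^n (1/2)_n n!\<close> cancels the powers of 2 and produces
  the lower parameter 1/2. The condition \<open>r\<^sup>2 < p * q\<close> places the argument inside
  the disc of convergence.\<close>

lemma nn_integral_abs_powr_exp_quadratic_form_hypergeometric:
  fixes \<alpha> \<beta> p q r :: real
  defines "a \<equiv> (\<alpha> + 1) / 2" and "b \<equiv> (\<beta> + 1) / 2"
  assumes \<alpha>: "\<alpha> > -1" and \<beta>: "\<beta> > -1" and p: "p > 0" and q: "q > 0" and r: "r\<^sup>2 < p * q"
  shows "(\<integral>\<^sup>+x. \<integral>\<^sup>+y. ennreal (\<bar>x\<bar> powr \<alpha> * \<bar>y\<bar> powr \<beta> * exp (- p * x\<^sup>2 - q * y\<^sup>2 + 2 * r * x * y)) \<partial>lborel \<partial>lborel)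
    = ennreal (Gamma a * Gamma b * p powr (- a) * q powr (- b) * hypergeometric a b (1/2) (r\<^sup>2 / (p * q)))"
proof -
  let ?x = "r\<^sup>2 / (p * q)" and ?C = "Gamma a * Gamma b * p powr (- a) * q powr (- b)"
  have ab: "a > 0" "b > 0" using \<alpha> \<beta> by (auto simp: a_def b_def)
  have x: "0 \<le> ?x" "?x < 1" using p q r by auto
  have summand: "(2 * r) ^ (2 * n) / fact (2 * n) * (Gamma (a + n) * p powr (- (a + n))) * (Gamma (b + n) * q powr (- (b + n)))
      = ?C * (hypergeometric_coeff a b (1/2) n * ?x ^ n)" for n
  proof -
    have G: "Gamma (z + n) = Gamma z * pochhammer z n" if "z > 0" for z :: real
      using that by (subst pochhammer_Gamma) (auto simp: Gamma_eq_zero_iff elim!: nonpos_Ints_cases)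
    have P: "z powr (- (s + n)) = z powr (- s) / z ^ n" if "z > 0" for z s :: real
      using that by (simp add: powr_diff powr_realpow)
    have "(fact (2 * n) :: real) = 4 ^ n * pochhammer (1/2) n * fact n"
      by (simp add: fact_double power_mult)
    then show ?thesis
      unfolding G[OF ab(1)] G[OF ab(2)] P[OF p] P[OF q] hypergeometric_coeff_def
      by (simp add: power_mult_distrib power_divide power_mult) (simp add: mult_ac)
  qed
  have "(\<lambda>n. ?C * (hypergeometric_coeff a b (1/2) n * ?x ^ n)) sums (?C * hypergeometric a b (1/2) ?x)"
    unfolding hypergeometric_def using x ab by (intro sums_mult summable_sums summable_hypergeometric_coeff) auto
  moreover have "0 \<le> ?C * (hypergeometric_coeff a b (1/2) n * ?x ^ n)" for n
    using ab x hypergeometric_coeff_pos[of a b "1/2" n] by (intro mult_nonneg_nonneg) (auto simp: Gamma_real_nonneg)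
  ultimately have "(\<Sum>n. ennreal (?C * (hypergeometric_coeff a b (1/2) n * ?x ^ n))) = ennreal (?C * hypergeometric a b (1/2) ?x)"
    by (intro suminf_ennreal_eq) auto
  then show ?thesis
    unfolding a_def b_def nn_integral_abs_powr_exp_quadratic_form[OF \<alpha> \<beta> p q]
    unfolding a_def[symmetric] b_def[symmetric] summand .
qed

section \<open>The bivariate normal density, its mixed moments and its origin from independent
  normals\<close>

definition centred_gaussian_density2 :: "real \<Rightarrow> real \<Rightarrow> real \<Rightarrow> real \<Rightarrow> real \<Rightarrow> real" where
  "centred_gaussian_density2 \<sigma>1 \<sigma>2 \<rho> x y =
     exp (- (x\<^sup>2 / \<sigma>1\<^sup>2 - 2 * \<rho> * x * y / (\<sigma>1 * \<sigma>2) + y\<^sup>2 / \<sigma>2\<^sup>2) / (2 * (1 - \<rho>\<^sup>2)))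
       / (2 * pi * \<sigma>1 * \<sigma>2 * sqrt (1 - \<rho>\<^sup>2))"

lemma borel_measurable_centred_gaussian_density2 [measurable]:
  "case_prod (centred_gaussian_density2 \<sigma>1 \<sigma>2 \<rho>) \<in> borel_measurable (borel \<Otimes>\<^sub>M borel)"
  unfolding centred_gaussian_density2_def by measurable

text \<open>The density is \<open>K * exp (- p * x\<^sup>2 - q * y\<^sup>2 + 2 * r * x * y)\<close>
  with \<open>r\<^sup>2 / (p * q) = \<rho>\<^sup>2\<close>. The power of
  \<open>1 - \<rho>\<^sup>2\<close> collects \<open>a\<close> from \<open>p\<close>,
  \<open>b\<close> from \<open>q\<close> and \<open>- 1/2\<close> from the normalising
  constant.\<close>

lemma nn_integral_abs_powr_centred_gaussian_density2:
  fixes \<alpha> \<beta> \<rho> \<sigma>1 \<sigma>2 :: real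
  defines "a \<equiv> (\<alpha> + 1) / 2" and "b \<equiv> (\<beta> + 1) / 2"
  assumes \<alpha>: "\<alpha> > -1" and \<beta>: "\<beta> > -1" and \<sigma>: "\<sigma>1 > 0" "\<sigma>2 > 0" and \<rho>: "\<bar>\<rho>\<bar> < 1"
  shows "(\<integral>\<^sup>+x. \<integral>\<^sup>+y. ennreal (\<bar>x\<bar> powr \<alpha> * \<bar>y\<bar> powr \<beta> * centred_gaussian_density2 \<sigma>1 \<sigma>2 \<rho> x y) \<partial>lborel \<partial>lborel)
    = ennreal (2 powr ((\<alpha> + \<beta>) / 2) / pi * \<sigma>1 powr \<alpha> * \<sigma>2 powr \<beta> * Gamma a * Gamma b
        * ((1 - \<rho>\<^sup>2) powr (a + b - 1/2) * hypergeometric a b (1/2) (\<rho>\<^sup>2)))"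
proof -
  define t where "t = 1 - \<rho>\<^sup>2"
  define p where "p = 1 / (2 * \<sigma>1\<^sup>2 * t)"
  define q where "q = 1 / (2 * \<sigma>2\<^sup>2 * t)"
  define r where "r = \<rho> / (2 * \<sigma>1 * \<sigma>2 * t)"
  define K where "K = 1 / (2 * pi * \<sigma>1 * \<sigma>2 * sqrt t)"
  have \<rho>2: "\<rho>\<^sup>2 < 1" using \<rho> by (simp add: abs_square_less_1)
  then have t: "t > 0" by (simp add: t_def)
  have pq: "p > 0" "q > 0" "K \<ge> 0" using \<sigma> t by (auto simp: p_def q_def K_def)
  have quot: "r\<^sup>2 / (p * q) = \<rho>\<^sup>2"
    using \<sigma> t by (simp add: p_def q_def r_def power_divide power_mult_distrib power2_eq_square)
  have "r\<^sup>2 < p * q"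
    using quot \<rho>2 pq by (metis divide_less_eq_1_pos mult_pos_pos)
  note I = nn_integral_abs_powr_exp_quadratic_form_hypergeometric[OF \<alpha> \<beta> pq(1,2) this, folded a_def b_def, unfolded quot]
  have dens: "centred_gaussian_density2 \<sigma>1 \<sigma>2 \<rho> x y = K * exp (- p * x\<^sup>2 - q * y\<^sup>2 + 2 * r * x * y)" for x y
  proof -
    have "- (x\<^sup>2 / \<sigma>1\<^sup>2 - 2 * \<rho> * x * y / (\<sigma>1 * \<sigma>2) + y\<^sup>2 / \<sigma>2\<^sup>2) / (2 * t) = - p * x\<^sup>2 - q * y\<^sup>2 + 2 * r * x * y"
      using \<sigma> t by (simp add: p_def q_def r_def field_simps)
    then show ?thesis unfolding centred_gaussian_density2_def t_def[symmetric] by (simp add: K_def)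
  qed
  have "(\<integral>\<^sup>+x. \<integral>\<^sup>+y. ennreal (\<bar>x\<bar> powr \<alpha> * \<bar>y\<bar> powr \<beta> * centred_gaussian_density2 \<sigma>1 \<sigma>2 \<rho> x y) \<partial>lborel \<partial>lborel)
    = (\<integral>\<^sup>+x. \<integral>\<^sup>+y. ennreal K * ennreal (\<bar>x\<bar> powr \<alpha> * \<bar>y\<bar> powr \<beta> * exp (- p * x\<^sup>2 - q * y\<^sup>2 + 2 * r * x * y)) \<partial>lborel \<partial>lborel)"
    using pq(3) by (intro nn_integral_cong) (simp add: dens mult_ac flip: ennreal_mult')
  also have "\<dots> = ennreal K * (\<integral>\<^sup>+x. \<integral>\<^sup>+y. ennreal (\<bar>x\<bar> powr \<alpha> * \<bar>y\<bar> powr \<beta> * exp (- p * x\<^sup>2 - q * y\<^sup>2 + 2 * r * x * y)) \<partial>lborel \<partial>lborel)"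
    by (simp add: nn_integral_cmult)
  also have "\<dots> = ennreal (K * (Gamma a * Gamma b * p powr (- a) * q powr (- b) * hypergeometric a b (1/2) (\<rho>\<^sup>2)))"
    unfolding I using pq(3) by (simp add: ennreal_mult')
  also have "K * (Gamma a * Gamma b * p powr (- a) * q powr (- b) * hypergeometric a b (1/2) (\<rho>\<^sup>2))
     = 2 powr ((\<alpha> + \<beta>) / 2) / pi * \<sigma>1 powr \<alpha> * \<sigma>2 powr \<beta> * Gamma a * Gamma b
        * (t powr (a + b - 1/2) * hypergeometric a b (1/2) (\<rho>\<^sup>2))"
  proof -
    \<comment> \<open>The surplus factors \<open>sqrt 2 * s\<close> of the two variables multiply to
      \<open>2 * \<sigma>1 * \<sigma>2\<close>, which cancels in \<open>K\<close> and leaves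
      \<open>1 / pi\<close>.\<close>
    have P: "(1 / (2 * s\<^sup>2 * t)) powr (- ((\<gamma> + 1) / 2)) = 2 powr (\<gamma> / 2) * sqrt 2 * s powr \<gamma> * s * t powr ((\<gamma> + 1) / 2)"
      if "s > 0" for s \<gamma>
    proof -
      have "(s\<^sup>2) powr ((\<gamma> + 1) / 2) = s powr \<gamma> * s"
      proof -
        have "(s powr 2) powr ((\<gamma> + 1) / 2) = s powr (2 * ((\<gamma> + 1) / 2))"
          by (rule powr_powr)
        also have "2 * ((\<gamma> + 1) / 2) = \<gamma> + 1" by simp
        finally show ?thesis using that by (simp add: powr_add)
      qed
      moreover have "2 powr ((\<gamma> + 1) / 2) = 2 powr (\<gamma> / 2) * sqrt (2::real)"
        by (simp add: add_divide_distrib powr_add powr_half_sqrt)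
      ultimately show ?thesis
        using that t by (simp add: powr_minus powr_divide powr_mult)
    qed
    have e1: "t powr (a + b - 1/2) = t powr a * t powr b / sqrt t"
      using t by (simp add: powr_add powr_diff powr_half_sqrt)
    have e2: "2 powr ((\<alpha> + \<beta>) / 2) = 2 powr (\<alpha> / 2) * 2 powr (\<beta> / 2 :: real)"
      by (simp add: add_divide_distrib powr_add)
    have e3: "p powr (- a) = 2 powr (\<alpha> / 2) * sqrt 2 * \<sigma>1 powr \<alpha> * \<sigma>1 * t powr a"
      "q powr (- b) = 2 powr (\<beta> / 2) * sqrt 2 * \<sigma>2 powr \<beta> * \<sigma>2 * t powr b"
      unfolding p_def q_def a_def b_def by (intro P \<sigma>)+
    show ?thesis
      unfolding e1 e2 e3 K_def using \<sigma> t by (simp add: field_simps)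
  qed
  finally show ?thesis unfolding t_def .
qed

text \<open>Under the linear map the bivariate density times the absolute determinant becomes the
  product of two standard normal densities.\<close>

lemma nn_integral_gaussian_linear:
  fixes a b c d \<sigma>1 \<sigma>2 \<rho> :: real and h :: "real \<times> real \<Rightarrow> ennreal"
  assumes h [measurable]: "h \<in> borel_measurable (borel \<Otimes>\<^sub>M borel)"
    and \<sigma>: "\<sigma>1 > 0" "\<sigma>2 > 0" and \<rho>: "\<bar>\<rho>\<bar> < 1"
    and cov: "a\<^sup>2 + b\<^sup>2 = \<sigma>1\<^sup>2" "c\<^sup>2 + d\<^sup>2 = \<sigma>2\<^sup>2" "a * c + b * d = \<rho> * \<sigma>1 * \<sigma>2"
  shows "(\<integral>\<^sup>+\<omega>. h (a * fst \<omega> + b * snd \<omega>, c * fst \<omega> + d * snd \<omega>)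
        \<partial>(std_normal_distribution \<Otimes>\<^sub>M std_normal_distribution))
    = (\<integral>\<^sup>+x. \<integral>\<^sup>+y. h (x, y) * ennreal (centred_gaussian_density2 \<sigma>1 \<sigma>2 \<rho> x y) \<partial>lborel \<partial>lborel)"
proof -
  let ?D = "a * d - b * c" and ?t = "1 - \<rho>\<^sup>2" and ?g = "centred_gaussian_density2 \<sigma>1 \<sigma>2 \<rho>"
  have t: "?t > 0" using \<rho> by (simp add: abs_square_less_1)
  \<comment> \<open>Lagrange's identity: the squared determinant is the determinant of the
    covariance matrix, positive because \<bar>\<rho>\<bar> < 1.\<close>
  have "?D\<^sup>2 = (a\<^sup>2 + b\<^sup>2) * (c\<^sup>2 + d\<^sup>2) - (a * c + b * d)\<^sup>2" by algebra
  then have D2: "?D\<^sup>2 = \<sigma>1\<^sup>2 * \<sigma>2\<^sup>2 * ?t"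
    unfolding cov by (simp add: algebra_simps power2_eq_square)
  then have D0: "?D \<noteq> 0" using \<sigma> t by (metis less_irrefl mult_pos_pos zero_less_power power_zero_numeral)
  have absD: "\<bar>?D\<bar> = \<sigma>1 * \<sigma>2 * sqrt ?t"
    using D2 \<sigma> by (metis abs_of_pos real_sqrt_abs real_sqrt_mult)
  have dens: "\<bar>?D\<bar> * ?g (a * z + b * w) (c * z + d * w) = std_normal_density z * std_normal_density w" for z w
  proof -
    let ?x = "a * z + b * w" and ?y = "c * z + d * w"
    \<comment> \<open>The adjugate of the covariance matrix, evaluated at the image of
      \<open>(z, w)\<close>, is the squared determinant times the Euclidean form.\<close>
    have "\<sigma>2\<^sup>2 * ?x\<^sup>2 - 2 * (\<rho> * \<sigma>1 * \<sigma>2) * ?x * ?y + \<sigma>1\<^sup>2 * ?y\<^sup>2 = ?D\<^sup>2 * (z\<^sup>2 + w\<^sup>2)"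
      unfolding cov[symmetric] by algebra
    then have "\<sigma>2\<^sup>2 * ?x\<^sup>2 - 2 * (\<rho> * \<sigma>1 * \<sigma>2) * ?x * ?y + \<sigma>1\<^sup>2 * ?y\<^sup>2 = \<sigma>1\<^sup>2 * \<sigma>2\<^sup>2 * ?t * (z\<^sup>2 + w\<^sup>2)"
      unfolding D2 .
    moreover have "?x\<^sup>2 / \<sigma>1\<^sup>2 - 2 * \<rho> * ?x * ?y / (\<sigma>1 * \<sigma>2) + ?y\<^sup>2 / \<sigma>2\<^sup>2
       = (\<sigma>2\<^sup>2 * ?x\<^sup>2 - 2 * (\<rho> * \<sigma>1 * \<sigma>2) * ?x * ?y + \<sigma>1\<^sup>2 * ?y\<^sup>2) / (\<sigma>1\<^sup>2 * \<sigma>2\<^sup>2)"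
      using \<sigma> by (simp add: add_divide_distrib diff_divide_distrib power2_eq_square)
    ultimately have "?x\<^sup>2 / \<sigma>1\<^sup>2 - 2 * \<rho> * ?x * ?y / (\<sigma>1 * \<sigma>2) + ?y\<^sup>2 / \<sigma>2\<^sup>2 = ?t * (z\<^sup>2 + w\<^sup>2)"
      using \<sigma> by simp
    then have "?g ?x ?y = exp (- (?t * (z\<^sup>2 + w\<^sup>2)) / (2 * ?t)) / (2 * pi * \<sigma>1 * \<sigma>2 * sqrt ?t)"
      unfolding centred_gaussian_density2_def by simp
    also have "- (?t * (z\<^sup>2 + w\<^sup>2)) / (2 * ?t) = - z\<^sup>2 / 2 + - w\<^sup>2 / 2"
      using t by (simp add: divide_simps) (simp add: algebra_simps)
    finally show ?thesis
      unfolding absD std_normal_density_def exp_add using \<sigma> t by (simp add: field_simps flip: power2_eq_square)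
  qed
  have sf: "sigma_finite_measure std_normal_distribution"
    by (intro prob_space_imp_sigma_finite prob_space_normal_density) simp
  have dens_prod: "std_normal_distribution \<Otimes>\<^sub>M std_normal_distribution
      = density (lborel \<Otimes>\<^sub>M lborel) (\<lambda>(z, w). ennreal (std_normal_density z) * ennreal (std_normal_density w))"
    by (intro pair_measure_density sf sigma_finite_lborel) auto
  have "(\<integral>\<^sup>+x. \<integral>\<^sup>+y. h (x, y) * ennreal (?g x y) \<partial>lborel \<partial>lborel)
     = ennreal \<bar>?D\<bar> * (\<integral>\<^sup>+z. \<integral>\<^sup>+w. h (a * z + b * w, c * z + d * w)
          * ennreal (?g (a * z + b * w) (c * z + d * w)) \<partial>lborel \<partial>lborel)"
    by (rule nn_integral_linear_change_of_variables[OF _ D0, of "\<lambda>x y. h (x, y) * ennreal (?g x y)"]) measurable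
  also have "\<dots> = (\<integral>\<^sup>+z. \<integral>\<^sup>+w. ennreal \<bar>?D\<bar> * (h (a * z + b * w, c * z + d * w)
          * ennreal (?g (a * z + b * w) (c * z + d * w))) \<partial>lborel \<partial>lborel)"
    by (simp add: nn_integral_cmult)
  also have "\<dots> = (\<integral>\<^sup>+z. \<integral>\<^sup>+w. (ennreal (std_normal_density z) * ennreal (std_normal_density w))
          * h (a * z + b * w, c * z + d * w) \<partial>lborel \<partial>lborel)"
  proof (intro nn_integral_cong)
    fix z w
    have "ennreal \<bar>?D\<bar> * ennreal (?g (a * z + b * w) (c * z + d * w))
        = ennreal (std_normal_density z) * ennreal (std_normal_density w)"
      using dens[of z w] by (simp flip: ennreal_mult')
    moreover have "k * (l * m) = k * m * l" for k l m :: ennreal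
      by (simp add: mult_ac)
    ultimately show "ennreal \<bar>?D\<bar> * (h (a * z + b * w, c * z + d * w) * ennreal (?g (a * z + b * w) (c * z + d * w)))
        = (ennreal (std_normal_density z) * ennreal (std_normal_density w)) * h (a * z + b * w, c * z + d * w)"
      by simp
  qed
  also have "\<dots> = (\<integral>\<^sup>+\<omega>. (case \<omega> of (z, w) \<Rightarrow> (ennreal (std_normal_density z) * ennreal (std_normal_density w))
          * h (a * z + b * w, c * z + d * w)) \<partial>(lborel \<Otimes>\<^sub>M lborel))"
    by (subst lborel.nn_integral_fst[symmetric]) auto
  also have "\<dots> = (\<integral>\<^sup>+\<omega>. h (a * fst \<omega> + b * snd \<omega>, c * fst \<omega> + d * snd \<omega>)
        \<partial>(std_normal_distribution \<Otimes>\<^sub>M std_normal_distribution))"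
    unfolding dens_prod by (subst nn_integral_density) (simp_all add: case_prod_unfold)
  finally show ?thesis ..
qed

subsection \<open>Gaussian vectors\<close>

lemma has_bochner_integral_pair_mult:
  fixes f g :: "_ \<Rightarrow> real"
  assumes "sigma_finite_measure M1" "sigma_finite_measure M2"
    and f: "integrable M1 f" and g: "integrable M2 g"
  shows "has_bochner_integral (M1 \<Otimes>\<^sub>M M2) (\<lambda>\<omega>. f (fst \<omega>) * g (snd \<omega>)) (integral\<^sup>L M1 f * integral\<^sup>L M2 g)"
proof -
  interpret pair_sigma_finite M1 M2 using assms(1,2) by (intro pair_sigma_finite.intro)
  note [measurable] = borel_measurable_integrable[OF f] borel_measurable_integrable[OF g]
  have int: "integrable (M1 \<Otimes>\<^sub>M M2) (\<lambda>\<omega>. f (fst \<omega>) * g (snd \<omega>))"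
    by (rule Fubini_integrable) (use f g in \<open>auto simp: abs_mult\<close>)
  have "integral\<^sup>L (M1 \<Otimes>\<^sub>M M2) (\<lambda>\<omega>. f (fst \<omega>) * g (snd \<omega>)) = integral\<^sup>L M1 f * integral\<^sup>L M2 g"
    using integral_fst'[OF int] by simp
  with int show ?thesis by (simp add: has_bochner_integral_iff)
qed

text \<open>Of the monomials in the expanded product only the constant and the two squares have
  nonzero integral. One formula thus yields means (second factor constantly 1), variances and
  covariances of affine images.\<close>

lemma has_bochner_integral_affine_std_normal:
  fixes p q r p' q' r' :: real
  defines "S \<equiv> std_normal_distribution"
  shows "has_bochner_integral (S \<Otimes>\<^sub>M S)
    (\<lambda>\<omega>. (p + q * fst \<omega> + r * snd \<omega>) * (p' + q' * fst \<omega> + r' * snd \<omega>)) (p * p' + q * q' + r * r')"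
proof -
  interpret S: prob_space S unfolding S_def by (rule prob_space_normal_density) simp
  note sf = S.sigma_finite_measure_axioms
  have int: "integrable S (\<lambda>x. x ^ k)" for k
    unfolding S_def by (rule integrable_std_normal_distribution_moment)
  have val: "integral\<^sup>L S (\<lambda>x. x ^ 1) = 0" "integral\<^sup>L S (\<lambda>x. x ^ 2) = 1"
    using integral_std_normal_distribution_moment_odd[of 1] std_normal_distribution_even_moments(1)[of 1]
    by (simp_all add: S_def)
  note H = has_bochner_integral_pair_mult[OF sf sf int int, unfolded S.prob_space]
  have H1: "has_bochner_integral (S \<Otimes>\<^sub>M S) (\<lambda>\<omega>. 1) (1::real)"
    using H[of 0 0] by (simp add: S.prob_space)
  have Hz: "has_bochner_integral (S \<Otimes>\<^sub>M S) (\<lambda>\<omega>. fst \<omega>) (0::real)"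
    using H[of 1 0] val by (simp add: S.prob_space)
  have Hw: "has_bochner_integral (S \<Otimes>\<^sub>M S) (\<lambda>\<omega>. snd \<omega>) (0::real)"
    using H[of 0 1] val by (simp add: S.prob_space)
  have Hzz: "has_bochner_integral (S \<Otimes>\<^sub>M S) (\<lambda>\<omega>. (fst \<omega>)\<^sup>2) (1::real)"
    using H[of 2 0] val by (simp add: S.prob_space)
  have Hww: "has_bochner_integral (S \<Otimes>\<^sub>M S) (\<lambda>\<omega>. (snd \<omega>)\<^sup>2) (1::real)"
    using H[of 0 2] val by (simp add: S.prob_space)
  have Hzw: "has_bochner_integral (S \<Otimes>\<^sub>M S) (\<lambda>\<omega>. fst \<omega> * snd \<omega>) (0::real)"
    using H[of 1 1] val by (simp add: S.prob_space)
  have "has_bochner_integral (S \<Otimes>\<^sub>M S)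
     (\<lambda>\<omega>. p * p' * 1 + (p * q' + q * p') * fst \<omega> + (p * r' + r * p') * snd \<omega>
        + q * q' * (fst \<omega>)\<^sup>2 + r * r' * (snd \<omega>)\<^sup>2 + (q * r' + r * q') * (fst \<omega> * snd \<omega>))
     (p * p' * 1 + (p * q' + q * p') * 0 + (p * r' + r * p') * 0
        + q * q' * 1 + r * r' * 1 + (q * r' + r * q') * 0)"
    by (intro has_bochner_integral_add has_bochner_integral_mult_right H1 Hz Hw Hzz Hww Hzw)
  moreover have "(\<lambda>\<omega>. p * p' * 1 + (p * q' + q * p') * fst \<omega> + (p * r' + r * p') * snd \<omega>
        + q * q' * (fst \<omega>)\<^sup>2 + r * r' * (snd \<omega>)\<^sup>2 + (q * r' + r * q') * (fst \<omega> * snd \<omega>))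
      = (\<lambda>\<omega>. (p + q * fst \<omega> + r * snd \<omega>) * (p' + q' * fst \<omega> + r' * snd \<omega>))"
    by (intro ext) (simp add: algebra_simps power2_eq_square)
  ultimately show ?thesis by simp
qed

text \<open>Only the joint law matters, and it is that of an affine image of two independent
  standard normals. Comparing first and second moments forces the shifts \<open>m\<close>,
  \<open>n\<close> to vanish and gives the three covariance equations of the linear case.\<close>

lemma centred_gaussian_nn_integral:
  fixes X1 X2 :: "'w \<Rightarrow> real" and \<sigma>1 \<sigma>2 \<rho> :: real
  assumes G: "jointly_gaussian M X1 X2"
    and mean: "integral\<^sup>L M X1 = 0" "integral\<^sup>L M X2 = 0"
    and \<sigma>: "\<sigma>1 > 0" "\<sigma>2 > 0"
    and var: "integral\<^sup>L M (\<lambda>\<omega>. (X1 \<omega>)\<^sup>2) = \<sigma>1\<^sup>2" "integral\<^sup>L M (\<lambda>\<omega>. (X2 \<omega>)\<^sup>2) = \<sigma>2\<^sup>2"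
    and cov: "integral\<^sup>L M (\<lambda>\<omega>. X1 \<omega> * X2 \<omega>) = \<rho> * \<sigma>1 * \<sigma>2" and \<rho>: "\<bar>\<rho>\<bar> < 1"
    and h [measurable]: "h \<in> borel_measurable (borel \<Otimes>\<^sub>M borel)"
  shows "(\<integral>\<^sup>+\<omega>. h (X1 \<omega>, X2 \<omega>) \<partial>M)
    = (\<integral>\<^sup>+x. \<integral>\<^sup>+y. h (x, y) * ennreal (centred_gaussian_density2 \<sigma>1 \<sigma>2 \<rho> x y) \<partial>lborel \<partial>lborel)"
proof -
  let ?N = "std_normal_distribution \<Otimes>\<^sub>M std_normal_distribution"
  from G obtain m n a b c d where [measurable]: "X1 \<in> borel_measurable M" "X2 \<in> borel_measurable M"
    and law: "distr M (borel \<Otimes>\<^sub>M borel) (\<lambda>\<omega>. (X1 \<omega>, X2 \<omega>)) =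
      distr ?N (borel \<Otimes>\<^sub>M borel) (\<lambda>(z, w). (m + a * z + b * w, n + c * z + d * w))"
    unfolding jointly_gaussian_def by blast
  let ?T = "\<lambda>\<omega>. (m + a * fst \<omega> + b * snd \<omega>, n + c * fst \<omega> + d * snd \<omega>)"
  have law': "distr M (borel \<Otimes>\<^sub>M borel) (\<lambda>\<omega>. (X1 \<omega>, X2 \<omega>)) = distr ?N (borel \<Otimes>\<^sub>M borel) ?T"
    using law by (simp add: case_prod_unfold)
  have E: "integral\<^sup>L M (\<lambda>\<omega>. f (X1 \<omega>, X2 \<omega>)) = integral\<^sup>L ?N (\<lambda>\<omega>. f (?T \<omega>))"
    if [measurable]: "f \<in> borel_measurable (borel \<Otimes>\<^sub>M borel)" for f :: "real \<times> real \<Rightarrow> real"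
    using arg_cong[OF law', of "\<lambda>L. integral\<^sup>L L f"] by (simp add: integral_distr)
  note A = has_bochner_integral_integral_eq[OF has_bochner_integral_affine_std_normal]
  have "m = 0"
    using mean(1) E[of fst] A[of m a b 1 0 0] by simp
  have "n = 0"
    using mean(2) E[of snd] A[of n c d 1 0 0] by simp
  have "a\<^sup>2 + b\<^sup>2 = \<sigma>1\<^sup>2"
    using var(1) E[of "\<lambda>x. (fst x)\<^sup>2"] A[of m a b m a b] \<open>m = 0\<close> by (simp add: power2_eq_square)
  moreover have "c\<^sup>2 + d\<^sup>2 = \<sigma>2\<^sup>2"
    using var(2) E[of "\<lambda>x. (snd x)\<^sup>2"] A[of n c d n c d] \<open>n = 0\<close> by (simp add: power2_eq_square)
  moreover have "a * c + b * d = \<rho> * \<sigma>1 * \<sigma>2"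
    using cov E[of "\<lambda>x. fst x * snd x"] A[of m a b n c d] \<open>n = 0\<close> \<open>m = 0\<close> by simp
  ultimately have "(\<integral>\<^sup>+\<omega>. h (a * fst \<omega> + b * snd \<omega>, c * fst \<omega> + d * snd \<omega>) \<partial>?N)
    = (\<integral>\<^sup>+x. \<integral>\<^sup>+y. h (x, y) * ennreal (centred_gaussian_density2 \<sigma>1 \<sigma>2 \<rho> x y) \<partial>lborel \<partial>lborel)"
    by (intro nn_integral_gaussian_linear h \<sigma> \<rho>)
  moreover have "(\<integral>\<^sup>+\<omega>. h (X1 \<omega>, X2 \<omega>) \<partial>M) = (\<integral>\<^sup>+\<omega>. h (?T \<omega>) \<partial>?N)"
    using arg_cong[OF law', of "\<lambda>L. integral\<^sup>N L h"] by (simp add: nn_integral_distr)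
  ultimately show ?thesis using \<open>m = 0\<close> \<open>n = 0\<close> by simp
qed

text \<open>All three expectations come from the mixed moment formula. In the single moments one
  exponent is 0, and there the power of \<open>1 - \<rho>\<^sup>2\<close> cancels the hypergeometric
  function.\<close>

lemma gaussian_moment_gap:
  fixes \<alpha> \<beta> \<rho> \<sigma>1 \<sigma>2 :: real
  defines "a \<equiv> (\<alpha> + 1) / 2" and "b \<equiv> (\<beta> + 1) / 2"
  assumes G: "jointly_gaussian M X1 X2"
    and mean: "integral\<^sup>L M X1 = 0" "integral\<^sup>L M X2 = 0"
    and \<sigma>: "\<sigma>1 > 0" "\<sigma>2 > 0"
    and var: "integral\<^sup>L M (\<lambda>\<omega>. (X1 \<omega>)\<^sup>2) = \<sigma>1\<^sup>2" "integral\<^sup>L M (\<lambda>\<omega>. (X2 \<omega>)\<^sup>2) = \<sigma>2\<^sup>2"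
    and cov: "integral\<^sup>L M (\<lambda>\<omega>. X1 \<omega> * X2 \<omega>) = \<rho> * \<sigma>1 * \<sigma>2" and \<rho>: "\<bar>\<rho>\<bar> < 1"
    and \<alpha>: "\<alpha> > -1" and \<beta>: "\<beta> > -1"
  shows "integral\<^sup>L M (\<lambda>\<omega>. \<bar>X1 \<omega>\<bar> powr \<alpha> * \<bar>X2 \<omega>\<bar> powr \<beta>)
      - integral\<^sup>L M (\<lambda>\<omega>. \<bar>X1 \<omega>\<bar> powr \<alpha>) * integral\<^sup>L M (\<lambda>\<omega>. \<bar>X2 \<omega>\<bar> powr \<beta>)
    = 2 powr ((\<alpha> + \<beta>) / 2) / pi * \<sigma>1 powr \<alpha> * \<sigma>2 powr \<beta> * Gamma a * Gamma b
        * ((1 - \<rho>\<^sup>2) powr (a + b - 1/2) * hypergeometric a b (1/2) (\<rho>\<^sup>2) - 1)"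
proof -
  have ab: "a > 0" "b > 0" using \<alpha> \<beta> by (auto simp: a_def b_def)
  have \<rho>2: "0 \<le> \<rho>\<^sup>2" "\<rho>\<^sup>2 < 1" using \<rho> by (simp_all add: abs_square_less_1)
  have [measurable]: "X1 \<in> borel_measurable M" "X2 \<in> borel_measurable M"
    using G by (simp_all add: jointly_gaussian_def)
  let ?g = "centred_gaussian_density2 \<sigma>1 \<sigma>2 \<rho>"
  \<comment> \<open>Agreement with the powers almost everywhere suffices, since the law of the pair
    has a density; so the constant 1 may stand for exponent 0.\<close>
  have E: "integral\<^sup>L M (\<lambda>\<omega>. f (X1 \<omega>) * g (X2 \<omega>)) = v"
    if [measurable]: "f \<in> borel_measurable borel" "g \<in> borel_measurable borel"
      and fg: "\<And>x. f x \<ge> 0" "\<And>x. g x \<ge> 0" and v: "v \<ge> 0"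
      and AE: "AE x in lborel. f x = \<bar>x\<bar> powr \<gamma>" "AE x in lborel. g x = \<bar>x\<bar> powr \<delta>"
      and I: "(\<integral>\<^sup>+x. \<integral>\<^sup>+y. ennreal (\<bar>x\<bar> powr \<gamma> * \<bar>y\<bar> powr \<delta> * ?g x y) \<partial>lborel \<partial>lborel) = ennreal v"
    for f g :: "real \<Rightarrow> real" and \<gamma> \<delta> v
  proof -
    have "(\<integral>\<^sup>+\<omega>. ennreal (f (X1 \<omega>) * g (X2 \<omega>)) \<partial>M)
        = (\<integral>\<^sup>+x. \<integral>\<^sup>+y. ennreal (f x * g y) * ennreal (?g x y) \<partial>lborel \<partial>lborel)"
      using centred_gaussian_nn_integral[OF G mean \<sigma> var cov \<rho>, of "\<lambda>x. ennreal (f (fst x) * g (snd x))"]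
      by simp
    also have "\<dots> = (\<integral>\<^sup>+x. \<integral>\<^sup>+y. ennreal (\<bar>x\<bar> powr \<gamma> * \<bar>y\<bar> powr \<delta> * ?g x y) \<partial>lborel \<partial>lborel)"
    proof (rule nn_integral_cong_AE, use AE(1) in eventually_elim)
      fix x assume x: "f x = \<bar>x\<bar> powr \<gamma>"
      show "(\<integral>\<^sup>+y. ennreal (f x * g y) * ennreal (?g x y) \<partial>lborel)
        = (\<integral>\<^sup>+y. ennreal (\<bar>x\<bar> powr \<gamma> * \<bar>y\<bar> powr \<delta> * ?g x y) \<partial>lborel)"
        by (rule nn_integral_cong_AE, use AE(2) in eventually_elim) (simp add: x ennreal_mult')
    qed
    finally show ?thesis
      using fg v unfolding I by (subst integral_eq_nn_integral) auto
  qed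
  have hyp: "(1 - \<rho>\<^sup>2) powr (a + b - 1/2) * hypergeometric a b (1/2) (\<rho>\<^sup>2) \<ge> 0"
    using ab \<rho>2 by (intro mult_nonneg_nonneg hypergeometric_nonneg) auto
  have E12: "integral\<^sup>L M (\<lambda>\<omega>. \<bar>X1 \<omega>\<bar> powr \<alpha> * \<bar>X2 \<omega>\<bar> powr \<beta>) =
      2 powr ((\<alpha> + \<beta>) / 2) / pi * \<sigma>1 powr \<alpha> * \<sigma>2 powr \<beta> * Gamma a * Gamma b
        * ((1 - \<rho>\<^sup>2) powr (a + b - 1/2) * hypergeometric a b (1/2) (\<rho>\<^sup>2))"
  proof (rule E[OF _ _ _ _ _ _ _ nn_integral_abs_powr_centred_gaussian_density2[OF \<alpha> \<beta> \<sigma> \<rho>, folded a_def b_def]])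
    show "0 \<le> 2 powr ((\<alpha> + \<beta>) / 2) / pi * \<sigma>1 powr \<alpha> * \<sigma>2 powr \<beta> * Gamma a * Gamma b
        * ((1 - \<rho>\<^sup>2) powr (a + b - 1/2) * hypergeometric a b (1/2) (\<rho>\<^sup>2))"
      using ab hyp by (auto intro!: mult_nonneg_nonneg[OF _ hyp] simp: Gamma_real_nonneg)
  qed auto
  \<comment> \<open>The single moments are the case where the other exponent is \<open>0\<close>, but \<open>0 powr 0 = 0\<close>.\<close>
  have nz: "AE x in lborel. 1 = \<bar>x\<bar> powr (0::real)"
    using AE_lborel_singleton[of "0::real"] by eventually_elim simp
  have E1: "integral\<^sup>L M (\<lambda>\<omega>. \<bar>X1 \<omega>\<bar> powr \<alpha>) = 2 powr (\<alpha> / 2) / sqrt pi * \<sigma>1 powr \<alpha> * Gamma a"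
  proof -
    have e: "2 powr ((\<alpha> + 0) / 2) / pi * \<sigma>1 powr \<alpha> * \<sigma>2 powr 0 * Gamma a * Gamma ((0 + 1) / 2)
        * ((1 - \<rho>\<^sup>2) powr (a + (0 + 1) / 2 - 1/2) * hypergeometric a ((0 + 1) / 2) (1/2) (\<rho>\<^sup>2))
        = 2 powr (\<alpha> / 2) / sqrt pi * \<sigma>1 powr \<alpha> * Gamma a"
      using hypergeometric_half_cancel[OF ab(1) \<rho>2] \<sigma> by (simp add: Gamma_one_half_real field_simps)
    have "integral\<^sup>L M (\<lambda>\<omega>. \<bar>X1 \<omega>\<bar> powr \<alpha> * 1) = 2 powr (\<alpha> / 2) / sqrt pi * \<sigma>1 powr \<alpha> * Gamma a"
      by (rule E[where g = "\<lambda>_. 1", OF _ _ _ _ _ _ nz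
          nn_integral_abs_powr_centred_gaussian_density2[OF \<alpha> _ \<sigma> \<rho>, folded a_def, of 0, unfolded e]])
        (use ab in \<open>auto simp: Gamma_real_nonneg\<close>)
    then show ?thesis by simp
  qed
  have E2: "integral\<^sup>L M (\<lambda>\<omega>. \<bar>X2 \<omega>\<bar> powr \<beta>) = 2 powr (\<beta> / 2) / sqrt pi * \<sigma>2 powr \<beta> * Gamma b"
  proof -
    have e: "2 powr ((0 + \<beta>) / 2) / pi * \<sigma>1 powr 0 * \<sigma>2 powr \<beta> * Gamma ((0 + 1) / 2) * Gamma b
        * ((1 - \<rho>\<^sup>2) powr ((0 + 1) / 2 + b - 1/2) * hypergeometric ((0 + 1) / 2) b (1/2) (\<rho>\<^sup>2))
        = 2 powr (\<beta> / 2) / sqrt pi * \<sigma>2 powr \<beta> * Gamma b"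
      using hypergeometric_half_cancel[OF ab(2) \<rho>2] \<sigma> hypergeometric_commute[of "1/2" b "1/2" "\<rho>\<^sup>2"]
      by (simp add: Gamma_one_half_real field_simps)
    have "integral\<^sup>L M (\<lambda>\<omega>. 1 * \<bar>X2 \<omega>\<bar> powr \<beta>) = 2 powr (\<beta> / 2) / sqrt pi * \<sigma>2 powr \<beta> * Gamma b"
      by (rule E[where f = "\<lambda>_. 1", OF _ _ _ _ _ nz _
          nn_integral_abs_powr_centred_gaussian_density2[OF _ \<beta> \<sigma> \<rho>, folded b_def, of 0, unfolded e]])
        (use ab in \<open>auto simp: Gamma_real_nonneg\<close>)
    then show ?thesis by simp
  qed
  have "integral\<^sup>L M (\<lambda>\<omega>. \<bar>X1 \<omega>\<bar> powr \<alpha>) * integral\<^sup>L M (\<lambda>\<omega>. \<bar>X2 \<omega>\<bar> powr \<beta>)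
      = 2 powr ((\<alpha> + \<beta>) / 2) / pi * \<sigma>1 powr \<alpha> * \<sigma>2 powr \<beta> * Gamma a * Gamma b"
    unfolding E1 E2 by (simp add: add_divide_distrib powr_add)
  then show ?thesis unfolding E12 by (simp add: right_diff_distrib)
qed

section \<open>Choice of the lower bound according to the exponents\<close>

theorem theorem2p1:
  fixes M :: "'w measure" and X1 X2 :: "'w \<Rightarrow> real"
    and \<sigma>1 \<sigma>2 \<rho> \<alpha>1 \<alpha>2 :: real
  assumes "prob_space M"
    and "jointly_gaussian M X1 X2"
    and "prob_space.expectation M X1 = 0" and "prob_space.expectation M X2 = 0"
    and "\<sigma>1 > 0" and "\<sigma>2 > 0"
    and "prob_space.expectation M (\<lambda>\<omega>. (X1 \<omega>)\<^sup>2) = \<sigma>1\<^sup>2"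
    and "prob_space.expectation M (\<lambda>\<omega>. (X2 \<omega>)\<^sup>2) = \<sigma>2\<^sup>2"
    and "\<rho> = prob_space.expectation M (\<lambda>\<omega>. X1 \<omega> * X2 \<omega>) / (\<sigma>1 * \<sigma>2)"
    and "\<bar>\<rho>\<bar> < 1"
    and "(\<alpha>1 \<in> {-1<..<0} \<and> \<alpha>2 \<in> {-1<..<0}) \<or> (\<alpha>1 \<in> {0<..} \<and> \<alpha>2 \<in> {0<..})"
  shows "prob_space.expectation M (\<lambda>\<omega>. \<bar>X1 \<omega>\<bar> powr \<alpha>1 * \<bar>X2 \<omega>\<bar> powr \<alpha>2)
           - prob_space.expectation M (\<lambda>\<omega>. \<bar>X1 \<omega>\<bar> powr \<alpha>1)
             * prob_space.expectation M (\<lambda>\<omega>. \<bar>X2 \<omega>\<bar> powr \<alpha>2)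
         \<ge> moment_gap_bound \<sigma>1 \<sigma>2 \<alpha>1 \<alpha>2 \<rho>
       \<and> moment_gap_bound \<sigma>1 \<sigma>2 \<alpha>1 \<alpha>2 \<rho> \<ge> 0"
proof -
  define a where "a = (\<alpha>1 + 1) / 2"
  define b where "b = (\<alpha>2 + 1) / 2"
  \<comment> \<open>This is the product of the two single moments.\<close>
  define C where "C = 2 powr ((\<alpha>1 + \<alpha>2) / 2) / pi * \<sigma>1 powr \<alpha>1 * \<sigma>2 powr \<alpha>2 * Gamma a * Gamma b"
  note \<sigma> = \<open>\<sigma>1 > 0\<close> \<open>\<sigma>2 > 0\<close>
  have \<alpha>: "\<alpha>1 > -1" "\<alpha>2 > -1" and sgn: "\<alpha>1 * \<alpha>2 > 0"
    using assms(11) by (auto simp: zero_less_mult_iff)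
  have ab: "a > 0" "b > 0" using \<alpha> by (auto simp: a_def b_def)
  then have \<Gamma>: "Gamma a > 0" "Gamma b > 0" by (simp_all add: Gamma_real_pos)
  have C: "C > 0" unfolding C_def using \<Gamma> \<sigma> by simp
  have \<rho>2: "0 \<le> \<rho>\<^sup>2" "\<rho>\<^sup>2 < 1" using assms(10) by (simp_all add: abs_square_less_1)
  have cov: "integral\<^sup>L M (\<lambda>\<omega>. X1 \<omega> * X2 \<omega>) = \<rho> * \<sigma>1 * \<sigma>2"
    using assms(9) \<sigma> by (simp add: field_simps)
  note gap = gaussian_moment_gap[OF assms(2,3,4) \<sigma> assms(7,8) cov assms(10) \<alpha>, folded a_def b_def, folded C_def]
  have factors: "(3/2 - a) * (3/2 - b) = (2 - \<alpha>1) * (2 - \<alpha>2) / 4"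
    by (simp add: a_def b_def field_simps)
  \<comment> \<open>Both ranges of exponents differ only in the lower bound \<open>L\<close> for the
    derivative factor with \<open>c = 3/2\<close>; \<open>L \<ge> 0\<close> yields the nonnegativity
    of the bound.\<close>
  have main: "?thesis" if bound: "moment_gap_bound \<sigma>1 \<sigma>2 \<alpha>1 \<alpha>2 \<rho> = C * (\<alpha>1 * \<alpha>2 / 2 * L * \<rho>\<^sup>2)" and "L \<ge> 0"
    and L: "\<And>y. 0 \<le> y \<Longrightarrow> y < 1 \<Longrightarrow> (1 - y) powr (a + b - 3/2) * hypergeometric a b (3/2) y \<ge> L" for L
  proof -
    have "(1 - \<rho>\<^sup>2) powr (a + b - 1/2) * hypergeometric a b (1/2) (\<rho>\<^sup>2) - 1 \<ge> \<alpha>1 * \<alpha>2 / 2 * L * \<rho>\<^sup>2"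
      unfolding a_def b_def
      by (rule gap_lower_bound[OF \<alpha> _ \<rho>2 L[unfolded a_def b_def]]) (use sgn in auto)
    then have "C * (\<alpha>1 * \<alpha>2 / 2 * L * \<rho>\<^sup>2)
        \<le> C * ((1 - \<rho>\<^sup>2) powr (a + b - 1/2) * hypergeometric a b (1/2) (\<rho>\<^sup>2) - 1)"
      using C by (intro mult_left_mono) auto
    moreover have "C * (\<alpha>1 * \<alpha>2 / 2 * L * \<rho>\<^sup>2) \<ge> 0"
      using C sgn \<open>L \<ge> 0\<close> by (intro mult_nonneg_nonneg) auto
    ultimately show ?thesis unfolding gap bound by simp
  qed
  let ?same = "(-1 < \<alpha>1 \<and> \<alpha>1 < 0 \<and> -1 < \<alpha>2 \<and> \<alpha>2 < 0) \<or>
         (0 < \<alpha>1 \<and> \<alpha>1 \<le> 2 \<and> 0 < \<alpha>2 \<and> \<alpha>2 \<le> 2) \<or> (2 \<le> \<alpha>1 \<and> 2 \<le> \<alpha>2)"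
  show ?thesis
  proof (cases ?same)
    case True
    then have "(3/2 - a) * (3/2 - b) \<ge> 0"
      unfolding factors by (auto simp: zero_le_mult_iff)
    then have "(1 - y) powr (a + b - 3/2) * hypergeometric a b (3/2) y \<ge> 1" if "0 \<le> y" "y < 1" for y
      using hypergeometric_transform_ge_1[of a b "3/2" y] ab that by simp
    moreover have "moment_gap_bound \<sigma>1 \<sigma>2 \<alpha>1 \<alpha>2 \<rho> = C * (\<alpha>1 * \<alpha>2 / 2 * 1 * \<rho>\<^sup>2)"
      unfolding moment_gap_bound_def if_P[OF True] C_def a_def b_def by (simp add: mult_ac)
    ultimately show ?thesis by (intro main[of 1]) auto
  next
    case False
    then have opp: "(2 < \<alpha>1 \<and> 0 < \<alpha>2 \<and> \<alpha>2 < 2) \<or> (0 < \<alpha>1 \<and> \<alpha>1 < 2 \<and> 2 < \<alpha>2)"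
      using assms(11) by auto
    \<comment> \<open>Gauss's constant for \<open>c = 3/2\<close>. Its denominator cancels the Gamma
      factors of \<open>C\<close>, and \<open>Gamma (3/2) = sqrt pi / 2\<close> turns
      \<open>1 / (2 * pi)\<close> into \<open>1 / (4 * sqrt pi)\<close>.\<close>
    let ?L = "Gamma (3/2) * Gamma (a + b - 3/2) / (Gamma a * Gamma b)"
    have s: "a + b - 3/2 = (\<alpha>1 + \<alpha>2 - 1) / 2" by (simp add: a_def b_def field_simps)
    \<comment> \<open>One exponent exceeds 2 and the other is positive, so their sum exceeds
      1.\<close>
    have s0: "a + b - 3/2 > 0" unfolding s using opp by auto
    have "(3/2 - a) * (3/2 - b) \<le> 0"
      unfolding factors using opp by (auto simp: mult_le_0_iff)
    then have "(1 - y) powr (a + b - 3/2) * hypergeometric a b (3/2) y \<ge> ?L" if "0 \<le> y" "y < 1" for y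
      using hypergeometric_transform_ge_Gauss[of a b "3/2" y] ab s0 that by simp
    moreover have "moment_gap_bound \<sigma>1 \<sigma>2 \<alpha>1 \<alpha>2 \<rho> = C * (\<alpha>1 * \<alpha>2 / 2 * ?L * \<rho>\<^sup>2)"
    proof -
      have "Gamma (3/2) = sqrt pi / (2::real)"
        using Gamma_plus1[of "1/2 :: real"] nonpos_Ints_nonpos[of "1/2 :: real"]
        by (auto simp: Gamma_one_half_real)
      moreover have "x / pi * sqrt pi = x / sqrt pi" for x :: real
        by (simp add: field_simps)
      ultimately show ?thesis
        unfolding moment_gap_bound_def if_not_P[OF False] if_P[OF opp] C_def s
        using \<Gamma> by (simp add: field_simps)
    qed
    moreover have "?L \<ge> 0" using ab s0 by (simp add: Gamma_real_nonneg)
    ultimately show ?thesis by (intro main[of ?L])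
  qed
qed

end
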